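(* Let $\mathcal{M}$ be an $\mathscr{L}$-structure with underlying set $M$ such that $|M|$ is a regular (infinite) cardinal. Suppose $\mathcal{M}$ is $|M|$-saturated, has quantifier-elimination, and has strong universal duplication of quantifier-free types. Then $\mathcal{M}$ is sunflowerable.
   Context: $\mathscr{L}$ is a first-order language all of whose function and relation symbols have finite arity. Script letters denote structures, Roman letters their underlying sets. For $B\subseteq M$, $\mathcal{M}\restriction_B$ is the substructure of $\mathcal{M}$ with underlying set $B$. Tuples may be infinite; $\mathrm{qtp}_{\mathcal{M}}(\mathbf{a})$ denotes the complete quantifier-free type of the tuple $\mathbf{a}$ in $\mathcal{M}$ (the set of literals true of $\mathbf{a}$). $\mathcal{M}$ has quantifier-elimination if its complete theory does. A set $Y$ of finite sets is a sunflower if there is a set $r$ such that $p\cap q=r$ for all distinct $p,q\in Y$. For $n\in\omega$, an infinite $\mathscr{L}$-structure $\mathcal{M}$ is $n$-sunflowerable if for every $\mathscr{L}$-structure $\mathcal{Y}\cong\mathcal{M}$ all of whose elements are sets of size $n$, there is a substructure $\mathcal{Z}\subseteq\mathcal{Y}$ with $\mathcal{Z}\cong\mathcal{Y}$ whose underlying set $Z$ is a sunflower. $\mathcal{M}$ is sunflowerable if it is $n$-sunflowerable for every $n\in\omega$. For a tuple $\mathbf{a}$ from $\mathcal{M}$ and $a\in M$ not in $\mathbf{a}$, let $B_{\mathbf{a},a}=\{b\in M: \mathrm{qtp}_{\mathcal{M}}(\mathbf{a},a)=\mathrm{qtp}_{\mathcal{M}}(\mathbf{a},b)\}$. $\mathcal{M}$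 has strong universal duplication of quantifier-free types if for every tuple $\mathbf{a}$ from $\mathcal{M}$ of length $<|M|$ and every $a\in M$ not in $\mathbf{a}$, we have $\mathcal{M}\restriction_{B_{\mathbf{a},a}}\cong\mathcal{M}$ (in particular $B_{\mathbf{a},a}$ is the underlying set of a substructure). *)

theory Defs
  imports Main
begin

unbundle cardinal_syntax


section \<open>First-order logic\<close>

text \<open>
  A language is given by sets of symbols, so that it may have no function symbols or no relation
  symbols at all. Constants are function symbols of arity 0. There is no bound on the number of
  symbols.
\<close>

record ('f, 'r) lang =
  fsyms :: "'f set"
  rsyms :: "'r set"
  farity :: "'f \<Rightarrow> nat"
  rarity :: "'r \<Rightarrow> nat"

datatype ('f, 'v) tm = Var 'v | Fn 'f "('f, 'v) tm list"

text \<open>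
  Falsity is a primitive formula, so that quantifier-free sentences exist in every language.
\<close>

datatype ('f, 'r, 'v) fm =
    Falsum
  | Eq "('f, 'v) tm" "('f, 'v) tm"
  | Rel 'r "('f, 'v) tm list"
  | Neg "('f, 'r, 'v) fm"
  | Conj "('f, 'r, 'v) fm" "('f, 'r, 'v) fm"
  | Ex 'v "('f, 'r, 'v) fm"

fun wf_tm :: "('f, 'r) lang \<Rightarrow> ('f, 'v) tm \<Rightarrow> bool" where
  "wf_tm L (Var x) \<longleftrightarrow> True"
| "wf_tm L (Fn f ts) \<longleftrightarrow> f \<in> fsyms L \<and> length ts = farity L f \<and> (\<forall>t\<in>set ts. wf_tm L t)"

fun wf_fm :: "('f, 'r) lang \<Rightarrow> ('f, 'r, 'v) fm \<Rightarrow> bool" where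
  "wf_fm L Falsum \<longleftrightarrow> True"
| "wf_fm L (Eq s t) \<longleftrightarrow> wf_tm L s \<and> wf_tm L t"
| "wf_fm L (Rel R ts) \<longleftrightarrow> R \<in> rsyms L \<and> length ts = rarity L R \<and> (\<forall>t\<in>set ts. wf_tm L t)"
| "wf_fm L (Neg \<phi>) \<longleftrightarrow> wf_fm L \<phi>"
| "wf_fm L (Conj \<phi> \<psi>) \<longleftrightarrow> wf_fm L \<phi> \<and> wf_fm L \<psi>"
| "wf_fm L (Ex x \<phi>) \<longleftrightarrow> wf_fm L \<phi>"

fun vars_tm :: "('f, 'v) tm \<Rightarrow> 'v set" where
  "vars_tm (Var x) = {x}"
| "vars_tm (Fn f ts) = (\<Union>t\<in>set ts. vars_tm t)"

fun free_vars :: "('f, 'r, 'v) fm \<Rightarrow> 'v set" where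
  "free_vars Falsum = {}"
| "free_vars (Eq s t) = vars_tm s \<union> vars_tm t"
| "free_vars (Rel R ts) = (\<Union>t\<in>set ts. vars_tm t)"
| "free_vars (Neg \<phi>) = free_vars \<phi>"
| "free_vars (Conj \<phi> \<psi>) = free_vars \<phi> \<union> free_vars \<psi>"
| "free_vars (Ex x \<phi>) = free_vars \<phi> - {x}"

fun quantifier_free :: "('f, 'r, 'v) fm \<Rightarrow> bool" where
  "quantifier_free (Neg \<phi>) \<longleftrightarrow> quantifier_free \<phi>"
| "quantifier_free (Conj \<phi> \<psi>) \<longleftrightarrow> quantifier_free \<phi> \<and> quantifier_free \<psi>"
| "quantifier_free (Ex x \<phi>) \<longleftrightarrow> False"
| "quantifier_free _ \<longleftrightarrow> True"

fun atomic :: "('f, 'r, 'v) fm \<Rightarrow> bool" where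
  "atomic (Eq s t) \<longleftrightarrow> True"
| "atomic (Rel R ts) \<longleftrightarrow> True"
| "atomic _ \<longleftrightarrow> False"

definition literal :: "('f, 'r, 'v) fm \<Rightarrow> bool" where
  "literal \<phi> \<longleftrightarrow> atomic \<phi> \<or> (\<exists>\<psi>. atomic \<psi> \<and> \<phi> = Neg \<psi>)"

text \<open>
  Interpretations are total functions on lists. Only their values at symbols of the language and
  lists of elements of the universe of the correct length are meaningful.
\<close>

record ('f, 'r, 'a) struct =
  univ :: "'a set"
  fun_int :: "'f \<Rightarrow> 'a list \<Rightarrow> 'a"
  rel_int :: "'r \<Rightarrow> 'a list \<Rightarrow> bool"

definition closed_under :: "('f, 'r) lang \<Rightarrow> ('f, 'r, 'a) struct \<Rightarrow> 'a set \<Rightarrow> bool" where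
  "closed_under L M B \<longleftrightarrow>
     (\<forall>f\<in>fsyms L. \<forall>xs\<in>lists B. length xs = farity L f \<longrightarrow> fun_int M f xs \<in> B)"

definition is_structure :: "('f, 'r) lang \<Rightarrow> ('f, 'r, 'a) struct \<Rightarrow> bool" where
  "is_structure L M \<longleftrightarrow> univ M \<noteq> {} \<and> closed_under L M (univ M)"

fun eval_tm :: "('f, 'r, 'a) struct \<Rightarrow> ('v \<Rightarrow> 'a) \<Rightarrow> ('f, 'v) tm \<Rightarrow> 'a" where
  "eval_tm M e (Var x) = e x"
| "eval_tm M e (Fn f ts) = fun_int M f (map (eval_tm M e) ts)"

fun sat :: "('f, 'r, 'a) struct \<Rightarrow> ('v \<Rightarrow> 'a) \<Rightarrow> ('f, 'r, 'v) fm \<Rightarrow> bool" where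
  "sat M e Falsum \<longleftrightarrow> False"
| "sat M e (Eq s t) \<longleftrightarrow> eval_tm M e s = eval_tm M e t"
| "sat M e (Rel R ts) \<longleftrightarrow> rel_int M R (map (eval_tm M e) ts)"
| "sat M e (Neg \<phi>) \<longleftrightarrow> \<not> sat M e \<phi>"
| "sat M e (Conj \<phi> \<psi>) \<longleftrightarrow> sat M e \<phi> \<and> sat M e \<psi>"
| "sat M e (Ex x \<phi>) \<longleftrightarrow> (\<exists>a\<in>univ M. sat M (e(x := a)) \<phi>)"


section \<open>Substructures and isomorphisms\<close>

definition isomorphism ::
  "('f, 'r) lang \<Rightarrow> ('f, 'r, 'a) struct \<Rightarrow> ('f, 'r, 'b) struct \<Rightarrow> ('a \<Rightarrow> 'b) \<Rightarrow> bool" where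
  "isomorphism L M N h \<longleftrightarrow>
     bij_betw h (univ M) (univ N) \<and>
     (\<forall>f\<in>fsyms L. \<forall>xs\<in>lists (univ M). length xs = farity L f \<longrightarrow>
        h (fun_int M f xs) = fun_int N f (map h xs)) \<and>
     (\<forall>R\<in>rsyms L. \<forall>xs\<in>lists (univ M). length xs = rarity L R \<longrightarrow>
        rel_int M R xs = rel_int N R (map h xs))"

definition isomorphic ::
  "('f, 'r) lang \<Rightarrow> ('f, 'r, 'a) struct \<Rightarrow> ('f, 'r, 'b) struct \<Rightarrow> bool" where
  "isomorphic L M N \<longleftrightarrow> (\<exists>h. isomorphism L M N h)"

definition substructure ::
  "('f, 'r) lang \<Rightarrow> ('f, 'r, 'a) struct \<Rightarrow> ('f, 'r, 'a) struct \<Rightarrow> bool" where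
  "substructure L N M \<longleftrightarrow>
     is_structure L N \<and> univ N \<subseteq> univ M \<and>
     (\<forall>f\<in>fsyms L. \<forall>xs\<in>lists (univ N). length xs = farity L f \<longrightarrow>
        fun_int N f xs = fun_int M f xs) \<and>
     (\<forall>R\<in>rsyms L. \<forall>xs\<in>lists (univ N). length xs = rarity L R \<longrightarrow>
        rel_int N R xs = rel_int M R xs)"

text \<open>
  The restriction of a structure to a subset of its universe is a substructure only if the subset
  is nonempty and closed under the functions of the language.
\<close>

definition restrict_struct :: "('f, 'r, 'a) struct \<Rightarrow> 'a set \<Rightarrow> ('f, 'r, 'a) struct" where
  "restrict_struct M B = M\<lparr>univ := B\<rparr>"


section \<open>Quantifier elimination\<close>

definition complete_theory ::
  "('f, 'r) lang \<Rightarrow> ('f, 'r, 'a) struct \<Rightarrow> ('f, 'r, nat) fm set" where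
  "complete_theory L M =
     {\<sigma>. wf_fm L \<sigma> \<and> free_vars \<sigma> = {} \<and> (\<forall>e. range e \<subseteq> univ M \<longrightarrow> sat M e \<sigma>)}"

definition model_of ::
  "('f, 'r) lang \<Rightarrow> ('f, 'r, nat) fm set \<Rightarrow> ('f, 'r, 'a) struct \<Rightarrow> bool" where
  "model_of L T N \<longleftrightarrow>
     is_structure L N \<and> (\<forall>\<sigma>\<in>T. \<forall>e. range e \<subseteq> univ N \<longrightarrow> sat N e \<sigma>)"

text \<open>
  Every formula is equivalent modulo \<open>T\<close> to a quantifier-free one with no new free variables.
  The models of \<open>T\<close> considered here have elements of type \<open>'a\<close>. If \<open>T\<close> is the complete theory of
  a structure with elements of type \<open>'a\<close>, this is no restriction, because then the universal
  closure of an equivalence that holds in this structure belongs to \<open>T\<close>.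
\<close>

definition theory_has_qe ::
  "'a itself \<Rightarrow> ('f, 'r) lang \<Rightarrow> ('f, 'r, nat) fm set \<Rightarrow> bool" where
  "theory_has_qe ty L T \<longleftrightarrow>
     (\<forall>\<phi> :: ('f, 'r, nat) fm. wf_fm L \<phi> \<longrightarrow>
       (\<exists>\<psi>. wf_fm L \<psi> \<and> quantifier_free \<psi> \<and> free_vars \<psi> \<subseteq> free_vars \<phi> \<and>
         (\<forall>N :: ('f, 'r, 'a) struct. model_of L T N \<longrightarrow>
           (\<forall>e. range e \<subseteq> univ N \<longrightarrow> sat N e \<phi> = sat N e \<psi>))))"

definition has_qe :: "('f, 'r) lang \<Rightarrow> ('f, 'r, 'a) struct \<Rightarrow> bool" where
  "has_qe L M \<longleftrightarrow> theory_has_qe TYPE('a) L (complete_theory L M)"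


section \<open>Saturation\<close>

text \<open>The language and the structure expanded by constants \<open>Inr a\<close> for the elements of \<open>A\<close>.\<close>

definition lang_const :: "('f, 'r) lang \<Rightarrow> 'a set \<Rightarrow> ('f + 'a, 'r) lang" where
  "lang_const L A =
     \<lparr>fsyms = fsyms L <+> A, rsyms = rsyms L,
      farity = case_sum (farity L) (\<lambda>_. 0), rarity = rarity L\<rparr>"

definition struct_const :: "('f, 'r, 'a) struct \<Rightarrow> ('f + 'a, 'r, 'a) struct" where
  "struct_const M =
     \<lparr>univ = univ M, fun_int = case_sum (fun_int M) (\<lambda>a _. a), rel_int = rel_int M\<rparr>"

definition unary_formulas ::
  "('f, 'r) lang \<Rightarrow> 'a set \<Rightarrow> ('f + 'a, 'r, nat) fm set" where
  "unary_formulas L A = {\<phi>. wf_fm (lang_const L A) \<phi> \<and> free_vars \<phi> \<subseteq> {0}}"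

definition realizes ::
  "('f, 'r, 'a) struct \<Rightarrow> 'a \<Rightarrow> ('f + 'a, 'r, nat) fm set \<Rightarrow> bool" where
  "realizes M b p \<longleftrightarrow> (\<forall>\<phi>\<in>p. sat (struct_const M) (\<lambda>_. b) \<phi>)"

definition complete_type ::
  "('f, 'r) lang \<Rightarrow> ('f, 'r, 'a) struct \<Rightarrow> 'a set \<Rightarrow> ('f + 'a, 'r, nat) fm set \<Rightarrow> bool" where
  "complete_type L M A p \<longleftrightarrow>
     p \<subseteq> unary_formulas L A \<and>
     (\<forall>q. finite q \<and> q \<subseteq> p \<longrightarrow> (\<exists>b\<in>univ M. realizes M b q)) \<and>
     (\<forall>\<phi>\<in>unary_formulas L A. \<phi> \<in> p \<or> Neg \<phi> \<in> p)"

definition saturated :: "('f, 'r) lang \<Rightarrow> ('f, 'r, 'a) struct \<Rightarrow> 'k rel \<Rightarrow> bool" where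
  "saturated L M \<kappa> \<longleftrightarrow>
     (\<forall>A p. A \<subseteq> univ M \<and> |A| <o \<kappa> \<and> complete_type L M A p \<longrightarrow>
        (\<exists>b\<in>univ M. realizes M b p))"


section \<open>Duplication of quantifier-free types\<close>

text \<open>
  A tuple is a family indexed by a set \<open>I\<close>, and the positions are used as the variables. The tuple
  \<open>t\<close> extended by one further entry \<open>b\<close> is indexed by \<open>insert None (Some ` I)\<close>.
\<close>

definition qtp ::
  "('f, 'r) lang \<Rightarrow> ('f, 'r, 'a) struct \<Rightarrow> 'i set \<Rightarrow> ('i \<Rightarrow> 'a) \<Rightarrow> ('f, 'r, 'i) fm set" where
  "qtp L M I t = {\<phi>. literal \<phi> \<and> wf_fm L \<phi> \<and> free_vars \<phi> \<subseteq> I \<and> sat M t \<phi>}"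

definition qtp_ext ::
  "('f, 'r) lang \<Rightarrow> ('f, 'r, 'a) struct \<Rightarrow> 'i set \<Rightarrow> ('i \<Rightarrow> 'a) \<Rightarrow> 'a \<Rightarrow> ('f, 'r, 'i option) fm set"
  where "qtp_ext L M I t b = qtp L M (insert None (Some ` I)) (case_option b t)"

definition qtp_class ::
  "('f, 'r) lang \<Rightarrow> ('f, 'r, 'a) struct \<Rightarrow> 'i set \<Rightarrow> ('i \<Rightarrow> 'a) \<Rightarrow> 'a \<Rightarrow> 'a set" where
  "qtp_class L M I t a = {b \<in> univ M. qtp_ext L M I t a = qtp_ext L M I t b}"

text \<open>
  Index sets are taken from the type of the elements of \<open>M\<close>. As only index sets of cardinality
  less than that of the universe matter, this covers tuples of every length below \<open>|univ M|\<close> up to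
  renaming of positions.
\<close>

definition strong_univ_dup_qf :: "('f, 'r) lang \<Rightarrow> ('f, 'r, 'a) struct \<Rightarrow> bool" where
  "strong_univ_dup_qf L M \<longleftrightarrow>
     (\<forall>(I :: 'a set) t a.
        |I| <o |univ M| \<and> t ` I \<subseteq> univ M \<and> a \<in> univ M \<and> a \<notin> t ` I \<longrightarrow>
        closed_under L M (qtp_class L M I t a) \<and>
        isomorphic L (restrict_struct M (qtp_class L M I t a)) M)"


section \<open>Sunflowers\<close>

definition sunflower :: "'b set set \<Rightarrow> bool" where
  "sunflower Y \<longleftrightarrow> (\<forall>p\<in>Y. finite p) \<and> (\<exists>r. \<forall>p\<in>Y. \<forall>q\<in>Y. p \<noteq> q \<longrightarrow> p \<inter> q = r)"

text \<open>
  The type argument \<open>'b\<close> is the type of the members of the \<open>n\<close>-element sets that make up the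
  copies of \<open>M\<close>. Statements about all copies are to be made for all \<open>'b\<close>.
\<close>

definition n_sunflowerable ::
  "'b itself \<Rightarrow> ('f, 'r) lang \<Rightarrow> ('f, 'r, 'a) struct \<Rightarrow> nat \<Rightarrow> bool" where
  "n_sunflowerable ty L M n \<longleftrightarrow>
     infinite (univ M) \<and>
     (\<forall>Y :: ('f, 'r, 'b set) struct.
        is_structure L Y \<and> isomorphic L Y M \<and> (\<forall>y\<in>univ Y. finite y \<and> card y = n) \<longrightarrow>
        (\<exists>Z. substructure L Z Y \<and> isomorphic L Z Y \<and> sunflower (univ Z)))"

definition sunflowerable ::
  "'b itself \<Rightarrow> ('f, 'r) lang \<Rightarrow> ('f, 'r, 'a) struct \<Rightarrow> bool" where
  "sunflowerable ty L M \<longleftrightarrow> (\<forall>n. n_sunflowerable TYPE('b) L M n)"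

end

theory Submission
  imports Defs
begin

text \<open>
  Call a set small if its cardinality is less than \<open>|univ M|\<close>, and write \<open>cell C x\<close> for the set of
  realizations of the quantifier-free type of \<open>x\<close> over a small set \<open>C\<close> not containing \<open>x\<close>; it is a
  copy of \<open>M\<close>. The main point is that \<open>M\<close> is not the union of a small family of sets \<open>A i\<close> none of
  which contains a copy of \<open>M\<close>. Trying to build a copy of \<open>M\<close> inside \<open>cell C x \<inter> A\<close> one element at a
  time must fail at some stage, and the type that cannot be realized there yields a smaller cell
  disjoint from \<open>A\<close>. Iterating this produces a decreasing chain of cells that avoid the \<open>A i\<close>
  successively; by regularity its parameters remain small in number, so by saturation the
  intersection is nonempty.

  Write \<open>s m\<close> for the \<open>n\<close>-element set in the place of \<open>m\<close>. The sunflower is found by induction on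
  \<open>n\<close>. If some \<open>\<beta>\<close> lies in all sets belonging to a copy of
  \<open>M\<close>, delete it and use the induction hypothesis. Otherwise a copy consisting of pairwise disjoint
  sets is built one element at a time: the next element must be taken from a cell and has to avoid
  the sets \<open>{m. \<beta> \<in> s m}\<close> for a small number of \<open>\<beta>\<close>, none of which contains a copy.
\<close>

section \<open>Evaluation, renaming and quantifier-free types\<close>

lemma eval_tm_cong:
  "(\<And>v. v \<in> vars_tm t \<Longrightarrow> e v = e' v) \<Longrightarrow> eval_tm M e t = eval_tm M e' t"
proof (induction t)
  case (Fn f ts)
  have "map (eval_tm M e) ts = map (eval_tm M e') ts"
    by (rule map_cong[OF refl], rule Fn.IH) (use Fn.prems in auto)
  then show ?case by (simp del: map_eq_conv)
qed simp

lemma sat_cong: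
  "(\<And>v. v \<in> free_vars \<phi> \<Longrightarrow> e v = e' v) \<Longrightarrow> sat M e \<phi> = sat M e' \<phi>"
proof (induction \<phi> arbitrary: e e')
  case (Eq s t)
  then show ?case using eval_tm_cong[of s e e' M] eval_tm_cong[of t e e' M] by simp
next
  case (Rel R ts)
  have "map (eval_tm M e) ts = map (eval_tm M e') ts"
    by (rule map_cong[OF refl], rule eval_tm_cong) (use Rel in auto)
  then show ?case by (simp del: map_eq_conv)
next
  case (Neg \<phi>)
  from Neg.IH[of e e'] Neg.prems show ?case by simp
next
  case (Conj \<phi> \<psi>)
  from Conj.IH(1)[of e e'] Conj.IH(2)[of e e'] Conj.prems show ?case by simp
next
  case (Ex x \<phi>)
  have "sat M (e(x := a)) \<phi> = sat M (e'(x := a)) \<phi>" for a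
    by (rule Ex.IH) (use Ex.prems in auto)
  then show ?case by simp
qed auto

lemma finite_vars_tm: "finite (vars_tm t)"
  by (induction t) auto

lemma finite_free_vars: "finite (free_vars \<phi>)"
  by (induction \<phi>) (auto simp: finite_vars_tm)

lemma finite_set1_tm: "finite (set1_tm t)"
  by (induction t) auto

lemma finite_set1_fm: "finite (set1_fm \<phi>)"
  by (induction \<phi>) (auto simp: finite_set1_tm)

lemma finite_set2_tm: "finite (set2_tm t)"
  by (induction t) auto

lemma finite_set3_fm: "finite (set3_fm \<phi>)"
  by (induction \<phi>) (auto simp: finite_set2_tm)

lemma vars_tm_set2_tm: "vars_tm t = set2_tm t"
  by (induction t) auto

lemma free_vars_subset_set3_fm: "free_vars \<phi> \<subseteq> set3_fm \<phi>"
  by (induction \<phi>) (auto simp: vars_tm_set2_tm)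

lemma eval_tm_map_tm: "eval_tm M e (map_tm id \<sigma> t) = eval_tm M (e \<circ> \<sigma>) t"
  by (induction t) (auto intro!: arg_cong[where f = "fun_int M _"])

lemma wf_tm_map_tm: "wf_tm L (map_tm id \<sigma> t) = wf_tm L t"
  by (induction t) auto

lemma vars_tm_map_tm: "vars_tm (map_tm id \<sigma> t) = \<sigma> ` vars_tm t"
  by (induction t) auto

section \<open>Equality of quantifier-free types\<close>

lemma qtp_eqI:
  assumes "\<And>\<phi>. atomic \<phi> \<Longrightarrow> wf_fm L \<phi> \<Longrightarrow> free_vars \<phi> \<subseteq> I \<Longrightarrow> sat M s \<phi> = sat M t \<phi>"
  shows "qtp L M I s = qtp L M I t"
proof -
  have "sat M s \<phi> = sat M t \<phi>" if "literal \<phi>" "wf_fm L \<phi>" "free_vars \<phi> \<subseteq> I" for \<phi>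
    using that assms unfolding literal_def by (elim disjE exE conjE) auto
  then show ?thesis unfolding qtp_def by blast
qed

lemma qtp_sat_eq:
  assumes "qtp L M I s = qtp L M I t" "quantifier_free \<phi>" "wf_fm L \<phi>" "free_vars \<phi> \<subseteq> I"
  shows "sat M s \<phi> = sat M t \<phi>"
proof -
  have lit: "sat M s \<psi> = sat M t \<psi>" if "atomic \<psi>" "wf_fm L \<psi>" "free_vars \<psi> \<subseteq> I" for \<psi>
    using that assms(1) unfolding qtp_def literal_def by blast
  show ?thesis using assms(2-)
  proof (induction \<phi>)
    case (Eq a b)
    then show ?case using lit[of "Eq a b"] by simp
  next
    case (Rel R ts)
    then show ?case using lit[of "Rel R ts"] by simp
  qed auto
qed

text \<open>Substituting \<open>\<sigma>\<close> for the variables turns an atomic formula over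
  \<open>J\<close> into one over \<open>I\<close>. Restrictions, compositions and changes of index
  set are all instances of this.\<close>

lemma qtp_reindex:
  assumes eq: "qtp L M I s = qtp L M I t"
    and \<sigma>: "\<And>j. j \<in> J \<Longrightarrow> \<sigma> j \<in> I \<and> s' j = s (\<sigma> j) \<and> t' j = t (\<sigma> j)"
  shows "qtp L M J s' = qtp L M J t'"
proof (rule qtp_eqI)
  fix \<phi> :: "('a, 'b, 'e) fm"
  assume a: "atomic \<phi>" "wf_fm L \<phi>" "free_vars \<phi> \<subseteq> J"
  let ?\<psi> = "map_fm id id \<sigma> \<phi>"
  have sat: "sat M e ?\<psi> = sat M (e \<circ> \<sigma>) \<phi>" for e
    using a(1) by (cases \<phi>) (auto simp: eval_tm_map_tm comp_def)
  have "free_vars ?\<psi> = \<sigma> ` free_vars \<phi>" "quantifier_free ?\<psi>" "wf_fm L ?\<psi>"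
    using a(1,2) by (cases \<phi>; auto simp: vars_tm_map_tm wf_tm_map_tm)+
  then have "sat M s ?\<psi> = sat M t ?\<psi>"
    using a(3) \<sigma> by (intro qtp_sat_eq[OF eq]) auto
  moreover have "sat M s' \<phi> = sat M (s \<circ> \<sigma>) \<phi>" "sat M t' \<phi> = sat M (t \<circ> \<sigma>) \<phi>"
    using a(3) \<sigma> by (auto intro!: sat_cong)
  ultimately show "sat M s' \<phi> = sat M t' \<phi>" by (simp add: sat)
qed

lemma qtp_cong: "(\<And>i. i \<in> I \<Longrightarrow> s i = t i) \<Longrightarrow> qtp L M I s = qtp L M I t"
  by (rule qtp_eqI) (auto intro!: sat_cong)

lemma qtp_imp_eq_iff:
  assumes "qtp L M I s = qtp L M I t" "i \<in> I" "j \<in> I"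
  shows "s i = s j \<longleftrightarrow> t i = t j"
  using qtp_sat_eq[OF assms(1), of "Eq (Var i) (Var j)"] assms by simp

lemma qtp_ext_insert:
  assumes "qtp_ext L M D s x = qtp_ext L M D t y" "d \<notin> D"
  shows "qtp L M (insert d D) (s(d := x)) = qtp L M (insert d D) (t(d := y))"
  using assms(1) unfolding qtp_ext_def
  by (rule qtp_reindex[where \<sigma> = "\<lambda>v. if v = d then None else Some v"]) (use assms(2) in auto)

lemma qtp_ext_reindex:
  assumes "qtp_ext L M D s x = qtp_ext L M D t y"
    and "\<And>j. j \<in> J \<Longrightarrow> \<sigma> j \<in> D \<and> s' j = s (\<sigma> j) \<and> t' j = t (\<sigma> j)"
  shows "qtp_ext L M J s' x = qtp_ext L M J t' y"
  using assms(1) unfolding qtp_ext_def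
  by (rule qtp_reindex[where \<sigma> = "map_option \<sigma>"]) (use assms(2) in auto)

lemma qtp_ext_cong:
  "(\<And>i. i \<in> D \<Longrightarrow> s i = t i) \<Longrightarrow> qtp_ext L M D s x = qtp_ext L M D t x"
  unfolding qtp_ext_def by (rule qtp_cong) auto

lemma qtp_ext_mono:
  assumes "qtp_ext L M D s x = qtp_ext L M D t y" "D' \<subseteq> D"
  shows "qtp_ext L M D' s x = qtp_ext L M D' t y"
  by (rule qtp_ext_reindex[OF assms(1), where \<sigma> = id]) (use assms(2) in auto)

text \<open>Both sides are instances of the atomic formula equating the new entry with entry
  \<open>d\<close>. Hence a realization of the type of a point outside the parameters again avoids
  them.\<close>

lemma qtp_ext_imp_mem_iff:
  assumes "qtp_ext L M D s x = qtp_ext L M D t y" "d \<in> D"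
  shows "x = s d \<longleftrightarrow> y = t d"
  using qtp_imp_eq_iff[OF assms(1)[unfolded qtp_ext_def], of None "Some d"] assms(2) by simp

section \<open>Constants as variables\<close>

abbreviation consts_fm :: "('f + 'c, 'r, 'v) fm \<Rightarrow> 'c set" where
  "consts_fm \<phi> \<equiv> {a. Inr a \<in> set1_fm \<phi>}"

text \<open>\<open>struct_const M\<close> is \<open>struct_interp M id\<close>; other interpretations of the constants let a
  partial elementary map act on formulas with parameters without changing the formulas.\<close>

definition struct_interp ::
  "('f, 'r, 'a) struct \<Rightarrow> ('c \<Rightarrow> 'a) \<Rightarrow> ('f + 'c, 'r, 'a) struct" where
  "struct_interp M k =
     \<lparr>univ = univ M, fun_int = case_sum (fun_int M) (\<lambda>a _. k a), rel_int = rel_int M\<rparr>"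

lemma struct_interp_simps [simp]:
  "univ (struct_interp M k) = univ M"
  "fun_int (struct_interp M k) (Inl f) xs = fun_int M f xs"
  "fun_int (struct_interp M k) (Inr c) xs = k c"
  "rel_int (struct_interp M k) = rel_int M"
  by (simp_all add: struct_interp_def)

lemma struct_const_eq: "struct_const M = struct_interp M id"
  by (simp add: struct_const_def struct_interp_def)

lemma finite_consts_fm: "finite (consts_fm \<phi>)"
  using finite_vimageI[OF finite_set1_fm, of Inr \<phi>] by (simp add: vimage_def)

lemma wf_tm_lang_const_iff:
  "wf_tm (lang_const L C) t \<longleftrightarrow> wf_tm (lang_const L UNIV) t \<and> {a. Inr a \<in> set1_tm t} \<subseteq> C"
  by (induction t) (auto simp: lang_const_def Ball_def)

lemma wf_fm_lang_const_iff:
  "wf_fm (lang_const L C) \<phi> \<longleftrightarrow> wf_fm (lang_const L UNIV) \<phi> \<and> consts_fm \<phi> \<subseteq> C"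
proof (induction \<phi>)
  case (Eq s t)
  then show ?case by (auto simp: wf_tm_lang_const_iff[of L C])
next
  case (Rel R ts)
  then show ?case by (auto simp: wf_tm_lang_const_iff[of L C]) (auto simp: lang_const_def)
qed auto

text \<open>Quantifier elimination speaks of formulas of \<open>L\<close> only, so each constant
  \<open>c\<close> has to be traded for a variable \<open>n c\<close> first.\<close>

fun const_var_tm :: "('c \<Rightarrow> 'v) \<Rightarrow> ('f + 'c, 'v) tm \<Rightarrow> ('f, 'v) tm" where
  "const_var_tm n (Var v) = Var v"
| "const_var_tm n (Fn (Inl f) ts) = Fn f (map (const_var_tm n) ts)"
| "const_var_tm n (Fn (Inr c) ts) = Var (n c)"

fun const_var_fm :: "('c \<Rightarrow> 'v) \<Rightarrow> ('f + 'c, 'r, 'v) fm \<Rightarrow> ('f, 'r, 'v) fm" where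
  "const_var_fm n Falsum = Falsum"
| "const_var_fm n (Eq s t) = Eq (const_var_tm n s) (const_var_tm n t)"
| "const_var_fm n (Rel R ts) = Rel R (map (const_var_tm n) ts)"
| "const_var_fm n (Neg \<phi>) = Neg (const_var_fm n \<phi>)"
| "const_var_fm n (Conj \<phi> \<psi>) = Conj (const_var_fm n \<phi>) (const_var_fm n \<psi>)"
| "const_var_fm n (Ex x \<phi>) = Ex x (const_var_fm n \<phi>)"

lemma wf_const_var_tm: "wf_tm (lang_const L C) t \<Longrightarrow> wf_tm L (const_var_tm n t)"
  by (induction n t rule: const_var_tm.induct) (auto simp: lang_const_def)

lemma wf_const_var_fm: "wf_fm (lang_const L C) \<phi> \<Longrightarrow> wf_fm L (const_var_fm n \<phi>)"
proof (induction \<phi>)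
  case (Rel R ts)
  then show ?case by (auto simp: wf_const_var_tm) (auto simp: lang_const_def)
qed (auto simp: wf_const_var_tm)

lemma vars_const_var_tm:
  "vars_tm (const_var_tm n t) \<subseteq> vars_tm t \<union> n ` {a. Inr a \<in> set1_tm t}"
  by (induction n t rule: const_var_tm.induct) fastforce+

lemma free_vars_const_var_fm:
  "free_vars (const_var_fm n \<phi>) \<subseteq> free_vars \<phi> \<union> n ` consts_fm \<phi>"
proof (induction \<phi>)
  case (Eq s t)
  then show ?case using vars_const_var_tm[of n s] vars_const_var_tm[of n t] by fastforce
next
  case (Rel R ts)
  show ?case using vars_const_var_tm[of n] by fastforce
qed fastforce+

lemma eval_const_var_tm:
  "(\<And>a. Inr a \<in> set1_tm t \<Longrightarrow> e (n a) = k a) \<Longrightarrow>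
    eval_tm M e (const_var_tm n t) = eval_tm (struct_interp M k) e t"
proof (induction n t rule: const_var_tm.induct)
  case (2 n f ts)
  have "map (eval_tm M e \<circ> const_var_tm n) ts = map (eval_tm (struct_interp M k) e) ts"
    unfolding comp_def by (rule map_cong[OF refl], rule "2.IH") (use "2.prems" in auto)
  then show ?case by (simp del: map_eq_conv)
qed simp_all

text \<open>\<open>set3_fm\<close> contains the bound variables too. Keeping every
  \<open>n c\<close> outside it prevents capture, so a quantifier leaves the values of the
  \<open>n c\<close> unchanged.\<close>

lemma sat_const_var_fm:
  "(\<And>a. a \<in> consts_fm \<phi> \<Longrightarrow> e (n a) = k a) \<Longrightarrow> n ` consts_fm \<phi> \<inter> set3_fm \<phi> = {} \<Longrightarrow>
    sat M e (const_var_fm n \<phi>) = sat (struct_interp M k) e \<phi>"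
proof (induction \<phi> arbitrary: e)
  case (Eq s t)
  then show ?case by (simp add: eval_const_var_tm[where k = k])
next
  case (Rel R ts)
  have "map (eval_tm M e) (map (const_var_tm n) ts) = map (eval_tm (struct_interp M k) e) ts"
    using Rel by (auto intro!: eval_const_var_tm)
  then show ?case by (simp del: map_map map_eq_conv)
next
  case (Conj \<phi> \<psi>)
  have "sat M e (const_var_fm n \<phi>) = sat (struct_interp M k) e \<phi>"
    by (rule Conj.IH(1)) (use Conj.prems in auto)
  moreover have "sat M e (const_var_fm n \<psi>) = sat (struct_interp M k) e \<psi>"
    by (rule Conj.IH(2)) (use Conj.prems in auto)
  ultimately show ?case by simp
next
  case (Ex x \<phi>)
  have "sat M (e(x := b)) (const_var_fm n \<phi>) = sat (struct_interp M k) (e(x := b)) \<phi>" for b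
    by (rule Ex.IH) (use Ex.prems in auto)
  then show ?case by simp
qed auto

text \<open>The converse translation; it is only meaningful for atomic formulas.\<close>

fun var_const_tm :: "('f, 'c option) tm \<Rightarrow> ('f + 'c, nat) tm" where
  "var_const_tm (Var None) = Var 0"
| "var_const_tm (Var (Some c)) = Fn (Inr c) []"
| "var_const_tm (Fn f ts) = Fn (Inl f) (map var_const_tm ts)"

fun var_const_fm :: "('f, 'r, 'c option) fm \<Rightarrow> ('f + 'c, 'r, nat) fm" where
  "var_const_fm (Eq s t) = Eq (var_const_tm s) (var_const_tm t)"
| "var_const_fm (Rel R ts) = Rel R (map var_const_tm ts)"
| "var_const_fm _ = Falsum"

lemma wf_var_const_tm:
  "wf_tm L t \<Longrightarrow> vars_tm t \<subseteq> insert None (Some ` C) \<Longrightarrow>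
    wf_tm (lang_const L C) (var_const_tm t)"
  by (induction t rule: var_const_tm.induct) (auto simp: lang_const_def)

lemma vars_var_const_tm: "vars_tm (var_const_tm t) \<subseteq> {0}"
  by (induction t rule: var_const_tm.induct) auto

lemma eval_var_const_tm:
  "eval_tm (struct_interp M k) (\<lambda>_. b) (var_const_tm t) = eval_tm M (case_option b k) t"
  by (induction t rule: var_const_tm.induct) (auto intro!: arg_cong[where f = "fun_int M _"])

lemma var_const_fm:
  assumes "atomic \<phi>" "wf_fm L \<phi>" "free_vars \<phi> \<subseteq> insert None (Some ` C)"
  shows "var_const_fm \<phi> \<in> unary_formulas L C"
    and "sat (struct_interp M k) (\<lambda>_. b) (var_const_fm \<phi>) = sat M (case_option b k) \<phi>"
proof -
  have "free_vars (var_const_fm \<phi>) \<subseteq> {0}"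
    using assms(1) vars_var_const_tm[where ?'a = 'a and ?'b = 'c] by (cases \<phi>) auto
  moreover have "wf_fm (lang_const L C) (var_const_fm \<phi>)"
    using assms
    by (cases \<phi>) (auto simp: UN_subset_iff lang_const_def intro!: wf_var_const_tm[unfolded lang_const_def])
  ultimately show "var_const_fm \<phi> \<in> unary_formulas L C"
    by (simp add: unary_formulas_def)
  show "sat (struct_interp M k) (\<lambda>_. b) (var_const_fm \<phi>) = sat M (case_option b k) \<phi>"
    using assms by (cases \<phi>) (auto simp: eval_var_const_tm comp_def)
qed

text \<open>Turns a finite part of a type into one formula, whose consistency is then a single
  existential statement.\<close>

fun conj_list :: "('f, 'r, 'v) fm list \<Rightarrow> ('f, 'r, 'v) fm" where
  "conj_list [] = Neg Falsum"
| "conj_list (\<phi> # \<phi>s) = Conj \<phi> (conj_list \<phi>s)"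

lemma wf_conj_list: "wf_fm L (conj_list \<phi>s) \<longleftrightarrow> (\<forall>\<phi>\<in>set \<phi>s. wf_fm L \<phi>)"
  by (induction \<phi>s) auto

lemma sat_conj_list: "sat M e (conj_list \<phi>s) \<longleftrightarrow> (\<forall>\<phi>\<in>set \<phi>s. sat M e \<phi>)"
  by (induction \<phi>s) auto

lemma free_vars_conj_list: "free_vars (conj_list \<phi>s) = (\<Union>\<phi>\<in>set \<phi>s. free_vars \<phi>)"
  by (induction \<phi>s) auto

section \<open>Realizing types\<close>

text \<open>\<open>M\<close> enumerates itself here, elements being positions. As equations are
  atomic, such an \<open>h\<close> is injective, and it is an embedding of structures
  (\<open>emb_isomorphism\<close>). Phrasing it through types makes \<open>qtp_reindex\<close>
  applicable.\<close>

definition emb :: "('f, 'r) lang \<Rightarrow> ('f, 'r, 'a) struct \<Rightarrow> ('a \<Rightarrow> 'a) \<Rightarrow> bool" where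
  "emb L M h \<longleftrightarrow> h ` univ M \<subseteq> univ M \<and> qtp L M (univ M) id = qtp L M (univ M) h"

definition contains_copy :: "('f, 'r) lang \<Rightarrow> ('f, 'r, 'a) struct \<Rightarrow> 'a set \<Rightarrow> bool" where
  "contains_copy L M S \<longleftrightarrow> (\<exists>h. emb L M h \<and> h ` univ M \<subseteq> S)"

lemma emb_id: "emb L M id"
  by (simp add: emb_def)

lemma emb_comp:
  assumes "emb L M g" "emb L M h"
  shows "emb L M (g \<circ> h)"
proof -
  have "qtp L M (univ M) (id \<circ> h) = qtp L M (univ M) (g \<circ> h)"
    by (rule qtp_reindex[of L M "univ M" id g _ h]) (use assms in \<open>auto simp: emb_def\<close>)
  then show ?thesis using assms by (simp add: emb_def image_subset_iff)
qed

section \<open>Small sets and transfer of truth by quantifier elimination\<close>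

locale saturated_structure =
  fixes L :: "('f, 'r) lang" and M :: "('f, 'r, 'a) struct"
  assumes struct: "is_structure L M"
    and inf: "infinite (univ M)"
    and reg: "regularCard |univ M|"
    and sat: "saturated L M |univ M|"
    and qe: "has_qe L M"
begin

abbreviation small :: "'b set \<Rightarrow> bool" where
  "small C \<equiv> |C| <o |univ M|"

lemma small_finite: "finite C \<Longrightarrow> small C"
  using inf finite_ordLess_infinite[OF card_of_Well_order card_of_Well_order, of C "univ M"]
  by (simp add: Field_card_of)

text \<open>The one place where regularity of the cardinality of \<open>M\<close> enters.\<close>

lemma small_UNION: "small I \<Longrightarrow> (\<And>i. i \<in> I \<Longrightarrow> small (A i)) \<Longrightarrow> small (\<Union>i\<in>I. A i)"
  using regularCard_UNION_bound[OF _ reg] inf card_of_Card_order[of "univ M"]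
  by (auto simp: cinfinite_def Field_card_of)

lemma small_subset: "small C \<Longrightarrow> D \<subseteq> C \<Longrightarrow> small D"
  using card_of_mono1 ordLeq_ordLess_trans by blast

lemma small_image: "small C \<Longrightarrow> small (g ` C)"
  using card_of_image ordLeq_ordLess_trans by blast

lemma small_Un: "small C \<Longrightarrow> small D \<Longrightarrow> small (C \<union> D)"
  using card_of_Un_ordLess_infinite inf by blast

text \<open>\<open>M\<close> is a model of its own complete theory, so the quantifier-free
  equivalent of \<open>\<phi>\<close> is valid in \<open>M\<close>, and quantifier-free types decide
  it.\<close>

lemma sat_eq_of_qtp:
  fixes \<phi> :: "('f, 'r, nat) fm"
  assumes wf: "wf_fm L \<phi>" and range: "range e \<subseteq> univ M" "range e' \<subseteq> univ M"
    and eq: "qtp L M (free_vars \<phi>) e = qtp L M (free_vars \<phi>) e'"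
  shows "sat M e \<phi> = sat M e' \<phi>"
proof -
  have model: "model_of L (complete_theory L M) M"
    using struct by (auto simp: model_of_def complete_theory_def)
  have "\<exists>\<psi>. wf_fm L \<psi> \<and> quantifier_free \<psi> \<and> free_vars \<psi> \<subseteq> free_vars \<phi> \<and>
      (\<forall>N :: ('f, 'r, 'a) struct. model_of L (complete_theory L M) N \<longrightarrow>
        (\<forall>e. range e \<subseteq> univ N \<longrightarrow> sat N e \<phi> = sat N e \<psi>))"
    using qe wf unfolding has_qe_def theory_has_qe_def by simp
  then obtain \<psi> where \<psi>: "wf_fm L \<psi>" "quantifier_free \<psi>" "free_vars \<psi> \<subseteq> free_vars \<phi>"
    and equiv: "\<And>e. range e \<subseteq> univ M \<Longrightarrow> sat M e \<phi> = sat M e \<psi>"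
    using model by auto
  show ?thesis
    using qtp_sat_eq[OF eq \<psi>(2,1,3)] equiv[OF range(1)] equiv[OF range(2)] by simp
qed

text \<open>The finitely many constants of \<open>\<phi>\<close> become fresh variables, which
  reduces the claim to \<open>sat_eq_of_qtp\<close>; \<open>C\<close> itself may be
  infinite.\<close>

lemma sat_interp_eq_of_qtp:
  fixes \<phi> :: "('f + 'c, 'r, nat) fm"
  assumes wf: "wf_fm (lang_const L C) \<phi>"
    and k: "k ` C \<subseteq> univ M" "k' ` C \<subseteq> univ M"
    and e: "e ` free_vars \<phi> \<subseteq> univ M" "e' ` free_vars \<phi> \<subseteq> univ M"
    and eq: "qtp L M (C <+> free_vars \<phi>) (case_sum k e) =
      qtp L M (C <+> free_vars \<phi>) (case_sum k' e')"
  shows "sat (struct_interp M k) e \<phi> = sat (struct_interp M k') e' \<phi>"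
proof -
  let ?K = "consts_fm \<phi>"
  have KC: "?K \<subseteq> C" using wf wf_fm_lang_const_iff[of L C \<phi>] by auto
  obtain n0 :: "'c \<Rightarrow> nat" where n0: "inj_on n0 ?K"
    using finite_imp_inj_to_nat_seg[OF finite_consts_fm[of \<phi>]] by auto
  \<comment> \<open>Shifting above every variable of \<open>\<phi>\<close>, bound ones included,
    gives freshness; \<open>insert 0\<close> keeps the set nonempty for \<open>Max\<close>.\<close>
  define n where "n c = Suc (Max (insert 0 (set3_fm \<phi>))) + n0 c" for c
  have inj: "inj_on n ?K" using n0 by (auto simp: inj_on_def n_def)
  have "v < n c" if "v \<in> set3_fm \<phi>" for v c
  proof -
    have "v \<le> Max (insert 0 (set3_fm \<phi>))"
      using that finite_set3_fm[of \<phi>] by (intro Max_ge) auto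
    then show ?thesis by (simp add: n_def)
  qed
  then have disj: "n ` ?K \<inter> set3_fm \<phi> = {}" by fastforce
  obtain m where m: "m \<in> univ M" using struct by (auto simp: is_structure_def)
  \<comment> \<open>The variable \<open>n c\<close> gets the value \<open>k c\<close>, and free
    variables keep theirs. The default \<open>m\<close> keeps the whole range inside the
    universe.\<close>
  define E :: "('c \<Rightarrow> 'a) \<Rightarrow> (nat \<Rightarrow> 'a) \<Rightarrow> nat \<Rightarrow> 'a" where "E k e v =
    (if v \<in> n ` ?K then k (inv_into ?K n v) else if v \<in> free_vars \<phi> then e v else m)" for k e v
  have E: "sat M (E k e) (const_var_fm n \<phi>) = sat (struct_interp M k) e \<phi>" for k e
  proof -
    have "sat M (E k e) (const_var_fm n \<phi>) = sat (struct_interp M k) (E k e) \<phi>"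
      using disj by (intro sat_const_var_fm) (auto simp: E_def inv_into_f_f[OF inj])
    also have "\<dots> = sat (struct_interp M k) e \<phi>"
      using disj free_vars_subset_set3_fm[of \<phi>] by (intro sat_cong) (auto simp: E_def)
    finally show ?thesis .
  qed
  have range: "range (E k e) \<subseteq> univ M" if "k ` C \<subseteq> univ M" "e ` free_vars \<phi> \<subseteq> univ M" for k e
    using that m KC by (auto simp: E_def inv_into_f_f[OF inj] image_subset_iff subset_iff)
  have "qtp L M (free_vars (const_var_fm n \<phi>)) (E k e) =
    qtp L M (free_vars (const_var_fm n \<phi>)) (E k' e')"
    using eq
  proof (rule qtp_reindex[where \<sigma> = "\<lambda>v. if v \<in> n ` ?K then Inl (inv_into ?K n v) else Inr v"])
    fix v assume "v \<in> free_vars (const_var_fm n \<phi>)"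
    then show "(if v \<in> n ` ?K then Inl (inv_into ?K n v) else Inr v) \<in> C <+> free_vars \<phi> \<and>
      E k e v = case_sum k e (if v \<in> n ` ?K then Inl (inv_into ?K n v) else Inr v) \<and>
      E k' e' v = case_sum k' e' (if v \<in> n ` ?K then Inl (inv_into ?K n v) else Inr v)"
      using free_vars_const_var_fm[of n \<phi>] KC
      by (cases "v \<in> n ` ?K") (auto simp: E_def inv_into_f_f[OF inj])
  qed
  then have "sat M (E k e) (const_var_fm n \<phi>) = sat M (E k' e') (const_var_fm n \<phi>)"
    using wf_const_var_fm[OF wf] range k e by (intro sat_eq_of_qtp) auto
  then show ?thesis by (simp add: E)
qed

lemma sat_interp_unary:
  assumes "\<phi> \<in> unary_formulas L C" "k ` C \<subseteq> univ M" "k' ` C \<subseteq> univ M" "x \<in> univ M" "y \<in> univ M"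
    and eq: "qtp_ext L M C k x = qtp_ext L M C k' y"
  shows "sat (struct_interp M k) (\<lambda>_. x) \<phi> = sat (struct_interp M k') (\<lambda>_. y) \<phi>"
proof (rule sat_interp_eq_of_qtp[of C])
  show "qtp L M (C <+> free_vars \<phi>) (case_sum k (\<lambda>_. x)) =
    qtp L M (C <+> free_vars \<phi>) (case_sum k' (\<lambda>_. y))"
    using eq unfolding qtp_ext_def
    by (rule qtp_reindex[where \<sigma> = "case_sum Some (\<lambda>_. None)"]) auto
qed (use assms in \<open>auto simp: unary_formulas_def\<close>)

text \<open>The parameters of the types are \<open>k ` D i\<close>; their formulas are written with the constants
  \<open>D i\<close>, and \<open>k\<close> is elementary on the union of these sets. With a single index this is
  homogeneity, and with \<open>k = id\<close> it is compactness for chains of types.\<close>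

lemma realize_chain:
  fixes J :: "'i set" and D :: "'i \<Rightarrow> 'a set"
  defines "C \<equiv> \<Union>i\<in>J. D i"
  assumes small: "small C" and CM: "C \<subseteq> univ M" and kC: "k ` C \<subseteq> univ M"
    and k: "qtp L M C id = qtp L M C k"
    and x: "\<And>i. i \<in> J \<Longrightarrow> x i \<in> univ M"
    and chain: "\<And>i j. i \<in> J \<Longrightarrow> j \<in> J \<Longrightarrow>
      D i \<subseteq> D j \<and> qtp_ext L M (D i) k (x i) = qtp_ext L M (D i) k (x j) \<or>
      D j \<subseteq> D i \<and> qtp_ext L M (D j) k (x j) = qtp_ext L M (D j) k (x i)"
  shows "\<exists>y\<in>univ M. \<forall>i\<in>J. qtp_ext L M (D i) k (x i) = qtp_ext L M (D i) id y"
proof (cases "J = {}")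
  case True
  then show ?thesis using struct by (auto simp: is_structure_def)
next
  case False
  let ?S = "\<lambda>i \<phi>. sat (struct_interp M k) (\<lambda>_. x i) \<phi>"
  have DC: "D i \<subseteq> C" if "i \<in> J" for i using that by (auto simp: C_def)
  \<comment> \<open>The union of the types of the \<open>x i\<close> over \<open>D i\<close>, with
    each constant \<open>c\<close> read as \<open>k c\<close>. It is to be realized with every
    constant read as itself.\<close>
  define p where "p = {\<phi>. \<exists>i\<in>J. \<phi> \<in> unary_formulas L (D i) \<and> ?S i \<phi>}"
  have unary_mono: "\<phi> \<in> unary_formulas L B" if "\<phi> \<in> unary_formulas L A" "A \<subseteq> B" for \<phi> A B
    using that wf_fm_lang_const_iff[of L A \<phi>] wf_fm_lang_const_iff[of L B \<phi>]
    by (auto simp: unary_formulas_def)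
  have pC: "p \<subseteq> unary_formulas L C"
    using unary_mono[OF _ DC] by (auto simp: p_def)
  \<comment> \<open>Along the chain the point with the larger parameter set satisfies the formulas
    of the other one, so finitely many members of \<open>p\<close> belong to a single stage.\<close>
  have fin: "\<exists>i\<in>J. \<forall>\<phi>\<in>q. \<phi> \<in> unary_formulas L (D i) \<and> ?S i \<phi>" if "finite q" "q \<subseteq> p" for q
    using that
  proof (induction q)
    case empty
    then show ?case using False by auto
  next
    case (insert \<phi> q)
    then obtain i where i: "i \<in> J" "\<And>\<psi>. \<psi> \<in> q \<Longrightarrow> \<psi> \<in> unary_formulas L (D i) \<and> ?S i \<psi>"
      by auto
    obtain j where j: "j \<in> J" "\<phi> \<in> unary_formulas L (D j)" "?S j \<phi>"
      using insert.prems by (auto simp: p_def)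
    have step: "\<psi> \<in> unary_formulas L (D b) \<and> ?S b \<psi>"
      if "a \<in> J" "b \<in> J" "D a \<subseteq> D b" "qtp_ext L M (D a) k (x a) = qtp_ext L M (D a) k (x b)"
        "\<psi> \<in> unary_formulas L (D a)" "?S a \<psi>" for a b \<psi>
    proof -
      have "k ` D a \<subseteq> univ M" using DC[OF that(1)] kC by auto
      then show ?thesis
        using sat_interp_unary[OF that(5) _ _ x[OF that(1)] x[OF that(2)] that(4)]
          unary_mono[OF that(5,3)] that(6) by simp
    qed
    from chain[OF i(1) j(1)] show ?case
    proof
      assume "D i \<subseteq> D j \<and> qtp_ext L M (D i) k (x i) = qtp_ext L M (D i) k (x j)"
      then show ?thesis using step[OF i(1) j(1)] i(2) j by (intro bexI[of _ j]) auto
    next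
      assume "D j \<subseteq> D i \<and> qtp_ext L M (D j) k (x j) = qtp_ext L M (D j) k (x i)"
      then show ?thesis using step[OF j(1) i(1)] i j by (intro bexI[of _ i]) auto
    qed
  qed
  have "complete_type L M C p"
    unfolding complete_type_def
  proof (intro conjI allI impI ballI)
    show "p \<subseteq> unary_formulas L C" by (rule pC)
  next
    fix q assume q: "finite q \<and> q \<subseteq> p"
    then obtain i where i: "i \<in> J" "\<And>\<phi>. \<phi> \<in> q \<Longrightarrow> \<phi> \<in> unary_formulas L (D i) \<and> ?S i \<phi>"
      using fin[of q] by auto
    obtain qs where qs: "set qs = q" using q finite_list by blast
    let ?\<Phi> = "conj_list qs"
    have fv: "free_vars ?\<Phi> \<subseteq> {0}"
      using i(2) qs by (auto simp: free_vars_conj_list unary_formulas_def)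
    have "sat (struct_interp M k) (\<lambda>_. x i) ?\<Phi>"
      using i(2) qs by (simp add: sat_conj_list)
    then have "sat (struct_interp M k) ((\<lambda>_. x i)(0 := x i)) ?\<Phi>"
      by (simp add: fun_upd_idem)
    then have "sat (struct_interp M k) (\<lambda>_. x i) (Ex 0 ?\<Phi>)"
      using x[OF i(1)] by auto
    \<comment> \<open>The point \<open>x i\<close> witnesses \<open>q\<close> only under
      \<open>k\<close>. Quantifying existentially removes the free variable, and as \<open>k\<close>
      preserves the type of \<open>C\<close>, the statement also holds with constants read as
      themselves.\<close>
    moreover have "sat (struct_interp M k) (\<lambda>_. x i) (Ex 0 ?\<Phi>) =
      sat (struct_interp M id) (\<lambda>_. x i) (Ex 0 ?\<Phi>)"
    proof (rule sat_interp_eq_of_qtp[of C])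
      show "wf_fm (lang_const L C) (Ex 0 ?\<Phi>)"
        using q qs pC by (auto simp: wf_conj_list unary_formulas_def)
      show "qtp L M (C <+> free_vars (Ex 0 ?\<Phi>)) (case_sum k (\<lambda>_. x i)) =
        qtp L M (C <+> free_vars (Ex 0 ?\<Phi>)) (case_sum id (\<lambda>_. x i))"
        using k[symmetric]
        by (rule qtp_reindex[where \<sigma> = "case_sum id undefined"]) (use fv in auto)
    qed (use CM kC x[OF i(1)] in auto)
    ultimately obtain b where b: "b \<in> univ M" "sat (struct_interp M id) ((\<lambda>_. x i)(0 := b)) ?\<Phi>"
      by auto
    have "sat (struct_interp M id) (\<lambda>_. b) ?\<Phi>"
      using b(2) fv by (subst sat_cong[of _ _ "(\<lambda>_. x i)(0 := b)"]) auto
    then show "\<exists>b\<in>univ M. realizes M b q"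
      using b(1) qs by (auto simp: realizes_def struct_const_eq sat_conj_list)
  next
    fix \<phi> assume \<phi>: "\<phi> \<in> unary_formulas L C"
    \<comment> \<open>By the chain condition finitely many constants lie in one \<open>D i\<close>,
      and that stage decides \<open>\<phi>\<close>.\<close>
    have "\<exists>i\<in>J. K \<subseteq> D i" if "finite K" "K \<subseteq> C" for K
      using that
    proof (induction K)
      case empty
      then show ?case using False by auto
    next
      case (insert c K)
      then obtain i j where "i \<in> J" "K \<subseteq> D i" "j \<in> J" "c \<in> D j" by (auto simp: C_def)
      then show ?case using chain[of i j] by blast
    qed
    from this[OF finite_consts_fm, of \<phi>] obtain i where i: "i \<in> J" "consts_fm \<phi> \<subseteq> D i"
      using \<phi> wf_fm_lang_const_iff[of L C \<phi>] by (auto simp: unary_formulas_def)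
    then have "\<phi> \<in> unary_formulas L (D i)"
      using \<phi> wf_fm_lang_const_iff[of L C \<phi>] wf_fm_lang_const_iff[of L "D i" \<phi>]
      by (auto simp: unary_formulas_def)
    then show "\<phi> \<in> p \<or> Neg \<phi> \<in> p"
      using i(1) by (cases "?S i \<phi>") (auto simp: p_def unary_formulas_def)
  qed
  then obtain y where y: "y \<in> univ M" "realizes M y p"
    using sat small CM unfolding saturated_def by blast
  have "qtp_ext L M (D i) k (x i) = qtp_ext L M (D i) id y" if i: "i \<in> J" for i
    unfolding qtp_ext_def
  proof (rule qtp_eqI)
    fix \<phi> :: "('f, 'r, 'a option) fm"
    assume \<phi>: "atomic \<phi>" "wf_fm L \<phi>" "free_vars \<phi> \<subseteq> insert None (Some ` D i)"
    let ?\<psi> = "var_const_fm \<phi>"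
    note \<psi> = var_const_fm[OF \<phi>]
    \<comment> \<open>Realizing \<open>p\<close> transfers true formulas only; false ones are
      handled through their negations.\<close>
    have neg: "Neg ?\<psi> \<in> unary_formulas L (D i)"
      using \<psi>(1) by (simp add: unary_formulas_def)
    have "sat (struct_interp M id) (\<lambda>_. y) ?\<psi>" if "?S i ?\<psi>"
      using y(2) that \<psi>(1) i unfolding realizes_def struct_const_eq p_def by blast
    moreover have "sat (struct_interp M id) (\<lambda>_. y) (Neg ?\<psi>)" if "\<not> ?S i ?\<psi>"
      using y(2) that neg i unfolding realizes_def struct_const_eq p_def by fastforce
    ultimately show "sat M (case_option (x i) k) \<phi> = sat M (case_option y id) \<phi>"
      by (auto simp: \<psi>(2))
  qed
  then show ?thesis using y(1) by blast
qed

end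

section \<open>Cells, and embeddings built by transfinite recursion\<close>

context saturated_structure
begin

abbreviation cell :: "'a set \<Rightarrow> 'a \<Rightarrow> 'a set" where
  "cell C x \<equiv> qtp_class L M C id x"

lemma mem_cell_iff: "b \<in> cell C x \<longleftrightarrow> b \<in> univ M \<and> qtp_ext L M C id x = qtp_ext L M C id b"
  by (simp add: qtp_class_def)

text \<open>Homogeneity: \<open>realize_chain\<close> is applied with a single index, with the image
  of \<open>D\<close> under \<open>g\<close> as constants and with the inverse of \<open>g\<close>
  as \<open>k\<close>. This carries the type of \<open>x\<close> over \<open>D\<close> to that
  image.\<close>

lemma one_point_extension:
  assumes D: "small D" "g ` D \<subseteq> univ M" "D \<subseteq> univ M"
    and eq: "qtp L M D id = qtp L M D g" and x: "x \<in> univ M"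
  shows "\<exists>y\<in>univ M. qtp_ext L M D id x = qtp_ext L M D g y"
proof -
  let ?k = "inv_into D g"
  have inj: "inj_on g D"
    using qtp_imp_eq_iff[OF eq] by (auto simp: inj_on_def)
  have k: "qtp L M (g ` D) id = qtp L M (g ` D) ?k"
    by (rule qtp_reindex[OF eq[symmetric], where \<sigma> = ?k])
      (auto simp: inv_into_f_f[OF inj])
  have "\<exists>y\<in>univ M. \<forall>i\<in>{()}. qtp_ext L M (g ` D) ?k x = qtp_ext L M (g ` D) id y"
    by (rule realize_chain) (use D x k small_image[OF D(1)] in \<open>auto simp: inv_into_f_f[OF inj]\<close>)
  then obtain y where y: "y \<in> univ M" "qtp_ext L M (g ` D) ?k x = qtp_ext L M (g ` D) id y"
    by auto
  have "qtp_ext L M D id x = qtp_ext L M D g y"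
    by (rule qtp_ext_reindex[OF y(2), where \<sigma> = g]) (auto simp: inv_into_f_f[OF inj])
  then show ?thesis using y(1) by auto
qed

lemma cell_chain_nonempty:
  assumes "small (\<Union>i\<in>J. D i)" "(\<Union>i\<in>J. D i) \<subseteq> univ M"
    and x: "\<And>i. i \<in> J \<Longrightarrow> x i \<in> univ M"
    and chain: "\<And>i j. i \<in> J \<Longrightarrow> j \<in> J \<Longrightarrow>
      D i \<subseteq> D j \<and> x j \<in> cell (D i) (x i) \<or> D j \<subseteq> D i \<and> x i \<in> cell (D j) (x j)"
  shows "\<exists>y\<in>univ M. \<forall>i\<in>J. y \<in> cell (D i) (x i)"
proof -
  have "\<exists>y\<in>univ M. \<forall>i\<in>J. qtp_ext L M (D i) id (x i) = qtp_ext L M (D i) id y"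
    by (rule realize_chain)
      (use assms(1,2) x chain in \<open>auto simp: mem_cell_iff\<close>)
  then show ?thesis by (auto simp: mem_cell_iff)
qed

abbreviation pred :: "'a \<Rightarrow> 'a set" where
  "pred j \<equiv> underS |univ M| j"

lemma pred_subset: "pred j \<subseteq> univ M"
  using underS_Field[of _ "|univ M|" j] by (auto simp: Field_card_of)

lemma pred_small: "j \<in> univ M \<Longrightarrow> small (pred j)"
  by (intro card_of_underS card_of_Card_order) (simp add: Field_card_of)

lemma linear_order_card_of: "linear_order_on A |A|"
  using card_of_well_order_on well_order_on_def by blast

lemma finite_has_maximum:
  assumes "finite F" "F \<noteq> {}" "F \<subseteq> A"
  shows "\<exists>m\<in>F. \<forall>z\<in>F. (z, m) \<in> |A|"
  using assms
proof (induction F rule: finite_ne_induct)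
  case (singleton x)
  then show ?case using linear_order_card_of[of A]
    by (auto simp: linear_order_on_def partial_order_on_def preorder_on_def refl_on_def)
next
  case (insert x F)
  then obtain m where m: "m \<in> F" "\<And>z. z \<in> F \<Longrightarrow> (z, m) \<in> |A|" by auto
  have lin: "refl_on A |A|" "trans |A|" "total_on A |A|"
    using linear_order_card_of[of A]
    by (auto simp: linear_order_on_def partial_order_on_def preorder_on_def)
  have xx: "(x, x) \<in> |A|" using lin(1) insert.prems by (auto simp: refl_on_def)
  have "(x, m) \<in> |A| \<or> (m, x) \<in> |A|"
    using lin(3) xx m(1) insert.prems by (cases "x = m") (auto simp: total_on_def)
  then show ?case
  proof
    assume "(x, m) \<in> |A|"
    then show ?thesis using m by auto
  next
    assume "(m, x) \<in> |A|"
    then show ?thesis using m xx transD[OF lin(2)] by (intro bexI[of _ x]) auto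
  qed
qed

text \<open>An atomic formula has finitely many variables. All of them except the largest one,
  \<open>m\<close>, lie in \<open>pred m\<close>, so the hypothesis at \<open>m\<close> decides the
  formula.\<close>

lemma qtp_eq_of_pred:
  assumes V: "V \<subseteq> univ M"
    and ext: "\<And>z. z \<in> V \<Longrightarrow> qtp_ext L M (pred z) id z = qtp_ext L M (pred z) f (f z)"
  shows "qtp L M V id = qtp L M V f"
proof (rule qtp_eqI)
  fix \<phi> :: "('f, 'r, 'a) fm"
  assume \<phi>: "atomic \<phi>" "wf_fm L \<phi>" "free_vars \<phi> \<subseteq> V"
  show "sat M id \<phi> = sat M f \<phi>"
  proof (cases "free_vars \<phi> = {}")
    case True
    then show ?thesis by (intro sat_cong) auto
  next
    case False
    obtain m where m: "m \<in> free_vars \<phi>" "\<And>z. z \<in> free_vars \<phi> \<Longrightarrow> (z, m) \<in> |univ M|"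
      using finite_has_maximum[OF finite_free_vars False] \<phi>(3) V by (meson order_trans)
    have sub: "free_vars \<phi> \<subseteq> insert m (pred m)"
      using m(2) by (auto simp: underS_def)
    have "qtp L M (insert m (pred m)) (id(m := m)) = qtp L M (insert m (pred m)) (f(m := f m))"
      using ext m(1) \<phi>(3) by (intro qtp_ext_insert) (auto simp: underS_def)
    then have "qtp L M (insert m (pred m)) id = qtp L M (insert m (pred m)) f"
      by (simp add: fun_upd_idem)
    then show ?thesis
      using \<phi>(1,2) sub by (rule_tac qtp_sat_eq) (cases \<phi>; auto)+
  qed
qed

text \<open>Transfinite recursion along \<open>|univ M|\<close>, all of whose proper initial segments are small.\<close>

lemma build_embedding:
  assumes S: "S \<subseteq> univ M"
    and step: "\<And>D g x. D \<subseteq> univ M \<Longrightarrow> small D \<Longrightarrow> g ` D \<subseteq> S \<Longrightarrow>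
      qtp L M D id = qtp L M D g \<Longrightarrow> x \<in> univ M - D \<Longrightarrow>
      \<exists>y\<in>S. qtp_ext L M D id x = qtp_ext L M D g y \<and> Q (g ` D) y"
  shows "\<exists>h. emb L M h \<and> h ` univ M \<subseteq> S \<and> (\<forall>j\<in>univ M. Q (h ` pred j) (h j))"
proof -
  \<comment> \<open>The guard makes the condition vacuous off the universe, since the recursion runs
    over the whole type. \<open>P f j\<close> looks at \<open>f\<close> only below \<open>j\<close>,
    as \<open>dependent_wf_choice\<close> requires.\<close>
  define P where "P f j y \<longleftrightarrow> (j \<in> univ M \<longrightarrow>
    y \<in> S \<and> qtp_ext L M (pred j) id j = qtp_ext L M (pred j) f y \<and> Q (f ` pred j) y)"
    for f j y
  have wf: "wf ( |univ M| - Id)"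
    using card_of_well_order_on well_order_on_def by blast
  have "\<exists>f. \<forall>x. P f x (f x)"
  proof (rule dependent_wf_choice[OF wf])
    fix f g :: "'a \<Rightarrow> 'a" and x r
    assume "\<And>z. (z, x) \<in> |univ M| - Id \<Longrightarrow> f z = g z"
    then have fg: "f z = g z" if "z \<in> pred x" for z using that by (auto simp: underS_def)
    then have "f ` pred x = g ` pred x" by auto
    moreover have "qtp_ext L M (pred x) f r = qtp_ext L M (pred x) g r"
      using fg by (rule qtp_ext_cong)
    ultimately show "P f x r = P g x r" by (simp add: P_def)
  next
    fix x and f :: "'a \<Rightarrow> 'a"
    assume "\<And>y. (y, x) \<in> |univ M| - Id \<Longrightarrow> P f y (f y)"
    then have IH: "P f y (f y)" if "y \<in> pred x" for y using that by (auto simp: underS_def)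
    show "\<exists>r. P f x r"
    proof (cases "x \<in> univ M")
      case True
      have eq: "qtp L M (pred x) id = qtp L M (pred x) f"
        using IH pred_subset by (intro qtp_eq_of_pred) (auto simp: P_def)
      have "f ` pred x \<subseteq> S" using IH pred_subset by (fastforce simp: P_def)
      moreover have "x \<in> univ M - pred x" using True by (auto simp: underS_def)
      ultimately obtain y where
        "y \<in> S" "qtp_ext L M (pred x) id x = qtp_ext L M (pred x) f y" "Q (f ` pred x) y"
        using step[OF pred_subset pred_small[OF True] _ eq] by blast
      then show ?thesis by (auto simp: P_def)
    qed (simp add: P_def)
  qed
  then obtain h where h: "\<And>x. P h x (h x)" by blast
  have "qtp L M (univ M) id = qtp L M (univ M) h"
    using h by (intro qtp_eq_of_pred) (auto simp: P_def)
  then have "emb L M h" "h ` univ M \<subseteq> S"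
    using h S by (auto simp: emb_def P_def)
  then show ?thesis using h by (auto simp: P_def)
qed

end

section \<open>Duplication of types and indivisibility\<close>

lemma eval_tm_isomorphism:
  assumes "isomorphism L (restrict_struct M B) M h" "closed_under L M B"
  shows "wf_tm L t \<Longrightarrow> e ` vars_tm t \<subseteq> B \<Longrightarrow>
    eval_tm M e t \<in> B \<and> eval_tm M (h \<circ> e) t = h (eval_tm M e t)"
proof (induction t)
  case (Fn f ts)
  let ?xs = "map (eval_tm M e) ts"
  have IH: "eval_tm M e t \<in> B \<and> eval_tm M (h \<circ> e) t = h (eval_tm M e t)" if "t \<in> set ts" for t
    by (rule Fn.IH[OF that]) (use Fn.prems that in auto)
  then have xs: "?xs \<in> lists B" "length ?xs = farity L f" "f \<in> fsyms L"
    using Fn.prems by auto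
  have "map (eval_tm M (h \<circ> e)) ts = map h ?xs" using IH by auto
  then have "eval_tm M (h \<circ> e) (Fn f ts) = fun_int M f (map h ?xs)"
    by (simp del: map_map map_eq_conv)
  moreover have "h (fun_int M f ?xs) = fun_int M f (map h ?xs)"
    using assms(1) xs unfolding isomorphism_def restrict_struct_def by (simp del: map_map)
  moreover have "fun_int M f ?xs \<in> B"
    using assms(2) xs unfolding closed_under_def by blast
  ultimately show ?case by (metis eval_tm.simps(2))
qed auto

text \<open>The restriction differs from \<open>M\<close> only in its universe, which the truth of
  an atomic formula does not consult; hence both types can be taken in \<open>M\<close>.\<close>

lemma qtp_isomorphism:
  assumes iso: "isomorphism L (restrict_struct M B) M h" and closed: "closed_under L M B"
    and e: "e ` I \<subseteq> B"
  shows "qtp L M I e = qtp L M I (h \<circ> e)"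
proof (rule qtp_eqI)
  fix \<phi> :: "('a, 'b, 'd) fm"
  assume \<phi>: "atomic \<phi>" "wf_fm L \<phi>" "free_vars \<phi> \<subseteq> I"
  have inj: "inj_on h B"
    using iso by (simp add: isomorphism_def restrict_struct_def bij_betw_def)
  have ev: "eval_tm M e t \<in> B \<and> eval_tm M (h \<circ> e) t = h (eval_tm M e t)"
    if "wf_tm L t" "vars_tm t \<subseteq> I" for t
    using eval_tm_isomorphism[OF iso closed that(1), of e] that(2) e by blast
  show "sat M e \<phi> = sat M (h \<circ> e) \<phi>"
  proof (cases \<phi>)
    case (Eq s t)
    then show ?thesis using \<phi> ev[of s] ev[of t] inj_on_eq_iff[OF inj] by auto
  next
    case (Rel R ts)
    let ?xs = "map (eval_tm M e) ts"
    have IH: "eval_tm M e t \<in> B \<and> eval_tm M (h \<circ> e) t = h (eval_tm M e t)"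
      if "t \<in> set ts" for t
      using \<phi> Rel that by (intro ev) auto
    then have "map (eval_tm M (h \<circ> e)) ts = map h ?xs" by auto
    moreover have "?xs \<in> lists B" "length ?xs = rarity L R" "R \<in> rsyms L"
      using \<phi> Rel IH by auto
    then have "rel_int M R ?xs = rel_int M R (map h ?xs)"
      using iso unfolding isomorphism_def restrict_struct_def by (simp del: map_map)
    ultimately show ?thesis using Rel by (simp del: map_map map_eq_conv)
  qed (use \<phi> in auto)
qed

section \<open>Cells as copies, and small families of sets without copies\<close>

locale duplicating_structure = saturated_structure L M
  for L :: "('f, 'r) lang" and M :: "('f, 'r, 'a) struct" +
  assumes dup: "strong_univ_dup_qf L M"
begin

text \<open>The form in which duplication enters: with \<open>C\<close> as its own enumeration, the
  isomorphism from the cell to \<open>M\<close> is inverted into an embedding whose image is exactly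
  the cell.\<close>

lemma cell_copy:
  assumes "C \<subseteq> univ M" "small C" "x \<in> univ M - C"
  shows "\<exists>h. emb L M h \<and> h ` univ M = cell C x"
proof -
  let ?B = "cell C x"
  have B: "closed_under L M ?B" "isomorphic L (restrict_struct M ?B) M"
    using dup[unfolded strong_univ_dup_qf_def, rule_format, of C id x] assms by auto
  then obtain h where h: "isomorphism L (restrict_struct M ?B) M h"
    unfolding isomorphic_def by blast
  then have bij: "bij_betw h ?B (univ M)"
    by (simp add: isomorphism_def restrict_struct_def)
  let ?g = "inv_into ?B h"
  have g: "?g ` univ M = ?B"
    using bij_betw_inv_into[OF bij] by (simp add: bij_betw_def)
  have "qtp L M (univ M) ?g = qtp L M (univ M) (h \<circ> ?g)"
    by (rule qtp_isomorphism[OF h B(1)]) (simp add: g)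
  also have "\<dots> = qtp L M (univ M) id"
    by (rule qtp_cong) (simp add: bij_betw_inv_into_right[OF bij])
  finally have "emb L M ?g"
    using g by (auto simp: emb_def mem_cell_iff)
  then show ?thesis using g by blast
qed

text \<open>A type that cannot be realized in \<open>cell C x \<inter> A\<close> is still realized
  by some \<open>y\<close> in \<open>cell C x\<close>, because this cell is a copy of
  \<open>M\<close> and inherits one-point extension. Adding the parameters of the type to
  \<open>C\<close> gives a cell around \<open>y\<close> that misses \<open>A\<close>.\<close>

lemma cell_avoiding:
  assumes A: "\<not> contains_copy L M A"
    and C: "C \<subseteq> univ M" "small C" "x \<in> univ M - C"
  shows "\<exists>C' x'. C \<subseteq> C' \<and> C' \<subseteq> univ M \<and> small C' \<and> x' \<in> cell C x \<and> x' \<in> univ M - C' \<and>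
    cell C' x' \<inter> A = {}"
proof -
  let ?S = "cell C x \<inter> A"
  have S: "?S \<subseteq> univ M" by (auto simp: mem_cell_iff)
  \<comment> \<open>A copy inside the intersection would lie inside \<open>A\<close>, so the
    hypothesis of \<open>build_embedding\<close> fails for some \<open>D\<close>, \<open>g\<close>,
    \<open>x0\<close>.\<close>
  have "\<not> (\<exists>h. emb L M h \<and> h ` univ M \<subseteq> ?S \<and> (\<forall>j\<in>univ M. True))"
    using A by (auto simp: contains_copy_def)
  then obtain D g x0 where D: "D \<subseteq> univ M" "small D" "g ` D \<subseteq> ?S"
    and eq: "qtp L M D id = qtp L M D g" and x0: "x0 \<in> univ M - D"
    and none: "\<And>y. y \<in> ?S \<Longrightarrow> qtp_ext L M D id x0 \<noteq> qtp_ext L M D g y"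
    using build_embedding[of ?S "\<lambda>_ _. True"] S by meson
  obtain h where h: "emb L M h" "h ` univ M = cell C x"
    using cell_copy[OF C] by blast
  then have hq: "qtp L M (univ M) id = qtp L M (univ M) h"
    by (simp add: emb_def)
  \<comment> \<open>\<open>g\<close> is pulled back along \<open>h\<close>, extended in
    \<open>M\<close>, and the new value \<open>y'\<close> is pushed forward into the cell.\<close>
  let ?g' = "inv_into (univ M) h \<circ> g"
  have g': "?g' d \<in> univ M" "h (?g' d) = g d" if "d \<in> D" for d
    using that D(3) h(2) by (auto simp: inv_into_into f_inv_into_f)
  have "qtp L M D ?g' = qtp L M D g"
    by (rule qtp_reindex[OF hq, where \<sigma> = ?g']) (use g' in simp)
  then obtain y' where y': "y' \<in> univ M" "qtp_ext L M D id x0 = qtp_ext L M D ?g' y'"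
    using one_point_extension[of D ?g' x0] D(1,2) g' eq x0 by auto
  define y where "y = h y'"
  have "qtp_ext L M D ?g' y' = qtp_ext L M D g y"
    unfolding qtp_ext_def y_def
    by (rule qtp_reindex[OF hq, where \<sigma> = "case_option y' ?g'"]) (use g' y'(1) in auto)
  with y'(2) have y: "qtp_ext L M D id x0 = qtp_ext L M D g y" by simp
  have yB: "y \<in> cell C x" using h(2) y'(1) by (auto simp: y_def)
  let ?C' = "C \<union> g ` D"
  have "y \<notin> g ` D"
    using qtp_ext_imp_mem_iff[OF y] x0 by auto
  moreover have "y \<notin> C"
    using yB C(3) qtp_ext_imp_mem_iff[of L M C id x id y y] by (auto simp: mem_cell_iff)
  moreover have "cell ?C' y \<inter> A = {}"
  proof -
    have False if b: "b \<in> cell ?C' y" "b \<in> A" for b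
    proof -
      have eqb: "qtp_ext L M ?C' id y = qtp_ext L M ?C' id b" "b \<in> univ M"
        using b(1) by (auto simp: mem_cell_iff)
      have "qtp_ext L M C id y = qtp_ext L M C id b"
        using qtp_ext_mono[OF eqb(1)] by blast
      then have "b \<in> cell C x" using yB eqb(2) by (auto simp: mem_cell_iff)
      moreover have "qtp_ext L M D g y = qtp_ext L M D g b"
        by (rule qtp_ext_reindex[OF eqb(1), where \<sigma> = g]) auto
      ultimately show False using none[of b] b(2) y by auto
    qed
    then show ?thesis by blast
  qed
  moreover have "?C' \<subseteq> univ M" "small ?C'"
    using C D small_Un[OF C(2) small_image[OF D(2)]] by (auto simp: mem_cell_iff)
  ultimately show ?thesis
    using yB by (intro exI[of _ ?C'] exI[of _ y]) (auto simp: mem_cell_iff)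
qed

lemma not_covered:
  fixes A :: "'l \<Rightarrow> 'a set"
  assumes \<Lambda>: "small \<Lambda>" and A: "\<And>i. i \<in> \<Lambda> \<Longrightarrow> \<not> contains_copy L M (A i)"
  shows "\<exists>y\<in>univ M. \<forall>i\<in>\<Lambda>. y \<notin> A i"
proof -
  let ?U = "underS |\<Lambda>|"
  \<comment> \<open>The pair \<open>p\<close> consists of a parameter set and a centre, and so codes
    a cell. Stage \<open>i\<close> must miss \<open>A i\<close> and refine the cells of all earlier
    stages.\<close>
  define P where "P f i p \<longleftrightarrow> (i \<in> \<Lambda> \<longrightarrow>
    fst p \<subseteq> univ M \<and> small (fst p) \<and> snd p \<in> univ M - fst p \<and> cell (fst p) (snd p) \<inter> A i = {} \<and>
    (\<forall>j\<in>?U i. fst (f j) \<subseteq> fst p \<and> snd p \<in> cell (fst (f j)) (snd (f j))))"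
    for f :: "'l \<Rightarrow> 'a set \<times> 'a" and i p
  have UL: "?U i \<subseteq> \<Lambda>" for i
    using underS_Field[of _ "|\<Lambda>|" i] by (auto simp: Field_card_of)
  \<comment> \<open>Needed twice: for an initial segment at each stage, and for
    \<open>V = \<Lambda>\<close> at the end.\<close>
  have lim: "\<exists>y\<in>univ M. \<forall>i\<in>V. y \<in> cell (fst (f i)) (snd (f i))"
    if V: "V \<subseteq> \<Lambda>" and P: "\<And>i. i \<in> V \<Longrightarrow> P f i (f i)" for V f
  proof (rule cell_chain_nonempty)
    show "small (\<Union>i\<in>V. fst (f i))"
      using P V by (intro small_UNION small_subset[OF \<Lambda> V]) (auto simp: P_def)
    have "fst (f i) \<subseteq> univ M \<and> snd (f i) \<in> univ M" if "i \<in> V" for i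
      using P[OF that] V that unfolding P_def by blast
    then show "(\<Union>i\<in>V. fst (f i)) \<subseteq> univ M" "\<And>i. i \<in> V \<Longrightarrow> snd (f i) \<in> univ M"
      by blast+
  next
    fix i j assume ij: "i \<in> V" "j \<in> V"
    consider "i = j" | "i \<in> ?U j" | "j \<in> ?U i"
      using linear_order_card_of[of \<Lambda>] ij V by (auto simp: linear_order_on_def total_on_def underS_def)
    then show "fst (f i) \<subseteq> fst (f j) \<and> snd (f j) \<in> cell (fst (f i)) (snd (f i)) \<or>
      fst (f j) \<subseteq> fst (f i) \<and> snd (f i) \<in> cell (fst (f j)) (snd (f j))"
    proof cases
      case 1
      then show ?thesis using P[OF ij(1)] ij V by (auto simp: P_def mem_cell_iff)
    next
      case 2
      then show ?thesis using P[OF ij(2)] ij V by (auto simp: P_def)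
    next
      case 3
      then show ?thesis using P[OF ij(1)] ij V by (auto simp: P_def)
    qed
  qed
  have wf: "wf ( |\<Lambda>| - Id)"
    using card_of_well_order_on well_order_on_def by blast
  have "\<exists>f. \<forall>i. P f i (f i)"
  proof (rule dependent_wf_choice[OF wf])
    fix f g :: "'l \<Rightarrow> 'a set \<times> 'a" and i p
    assume "\<And>z. (z, i) \<in> |\<Lambda>| - Id \<Longrightarrow> f z = g z"
    then have "f z = g z" if "z \<in> ?U i" for z using that by (auto simp: underS_def)
    then show "P f i p = P g i p" by (simp add: P_def)
  next
    fix i and f :: "'l \<Rightarrow> 'a set \<times> 'a"
    assume "\<And>j. (j, i) \<in> |\<Lambda>| - Id \<Longrightarrow> P f j (f j)"
    then have IH: "P f j (f j)" if "j \<in> ?U i" for j using that by (auto simp: underS_def)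
    show "\<exists>p. P f i p"
    proof (cases "i \<in> \<Lambda>")
      case True
      let ?C = "\<Union>j\<in>?U i. fst (f j)"
      obtain y where y: "y \<in> univ M" "\<And>j. j \<in> ?U i \<Longrightarrow> y \<in> cell (fst (f j)) (snd (f j))"
        using lim[OF UL IH] by blast
      have j: "j \<in> \<Lambda>" "fst (f j) \<subseteq> univ M" "small (fst (f j))" "snd (f j) \<notin> fst (f j)"
        if "j \<in> ?U i" for j
        using IH[OF that] UL that by (auto simp: P_def)
      have C: "?C \<subseteq> univ M" "small ?C"
        using j by (auto intro!: small_UNION small_subset[OF \<Lambda> UL])
      \<comment> \<open>The centre of an earlier cell is not a parameter of it, and all members
        agree with the centre on equations with parameters. So \<open>y\<close> may serve as a
        centre over \<open>?C\<close>.\<close>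
      have "y \<notin> fst (f j)" if "j \<in> ?U i" for j
        using y(2)[OF that] j(4)[OF that]
          qtp_ext_imp_mem_iff[of L M "fst (f j)" id "snd (f j)" id y y]
        by (auto simp: mem_cell_iff)
      with y(1) have "y \<in> univ M - ?C" by auto
      from cell_avoiding[OF A[OF True] C this] obtain C' x' where
        C': "?C \<subseteq> C'" "C' \<subseteq> univ M" "small C'" "x' \<in> cell ?C y" "x' \<in> univ M - C'"
          "cell C' x' \<inter> A i = {}"
        by blast
      \<comment> \<open>\<open>x'\<close> agrees with \<open>y\<close> over \<open>?C\<close>, hence
        over each earlier parameter set, so the new cell refines every earlier one.\<close>
      have "fst (f j) \<subseteq> C' \<and> x' \<in> cell (fst (f j)) (snd (f j))" if "j \<in> ?U i" for j
      proof -
        have "qtp_ext L M (fst (f j)) id y = qtp_ext L M (fst (f j)) id x'"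
          by (rule qtp_ext_mono[of L M ?C]) (use C'(4) that in \<open>auto simp: mem_cell_iff\<close>)
        then show ?thesis using C' y(2)[OF that] that by (auto simp: mem_cell_iff)
      qed
      then show ?thesis using C' by (intro exI[of _ "(C', x')"]) (auto simp: P_def)
    qed (simp add: P_def)
  qed
  then obtain f where f: "\<And>i. P f i (f i)" by blast
  obtain y where y: "y \<in> univ M" "\<And>i. i \<in> \<Lambda> \<Longrightarrow> y \<in> cell (fst (f i)) (snd (f i))"
    using lim[of \<Lambda> f] f by blast
  then show ?thesis using f by (intro bexI[of _ y]) (auto simp: P_def)
qed

text \<open>The cell is the image of an embedding \<open>h\<close>, so \<open>not_covered\<close> is
  applied to the preimages of the \<open>A i\<close>; a copy in a preimage would be carried by
  \<open>h\<close> to a copy in \<open>A i\<close>.\<close>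

lemma cell_not_covered:
  fixes A :: "'l \<Rightarrow> 'a set"
  assumes \<Lambda>: "small \<Lambda>" and A: "\<And>i. i \<in> \<Lambda> \<Longrightarrow> \<not> contains_copy L M (A i)"
    and C: "C \<subseteq> univ M" "small C" "x \<in> univ M - C"
  shows "\<exists>y\<in>cell C x. \<forall>i\<in>\<Lambda>. y \<notin> A i"
proof -
  obtain h where h: "emb L M h" "h ` univ M = cell C x"
    using cell_copy[OF C] by blast
  have "\<not> contains_copy L M (h -` A i)" if i: "i \<in> \<Lambda>" for i
  proof
    assume "contains_copy L M (h -` A i)"
    then obtain g where "emb L M g" "g ` univ M \<subseteq> h -` A i" by (auto simp: contains_copy_def)
    then have "emb L M (h \<circ> g)" "(h \<circ> g) ` univ M \<subseteq> A i" using emb_comp[OF h(1)] by auto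
    then show False using A[OF i] unfolding contains_copy_def by blast
  qed
  from not_covered[OF \<Lambda>, of "\<lambda>i. h -` A i", OF this] obtain y where
    "y \<in> univ M" "\<And>i. i \<in> \<Lambda> \<Longrightarrow> h y \<notin> A i"
    by auto
  then show ?thesis using h(2) by blast
qed

section \<open>Sunflowers\<close>

text \<open>The sets are merely attached to elements by \<open>s\<close> and carry no structure, so
  the induction is free to pass to a reindexed and reduced family.\<close>

lemma sunflower_embedding:
  fixes s :: "'a \<Rightarrow> 'b set"
  assumes "\<And>m. m \<in> univ M \<Longrightarrow> finite (s m) \<and> card (s m) = n"
  shows "\<exists>h r. emb L M h \<and> (\<forall>u\<in>univ M. \<forall>v\<in>univ M. u \<noteq> v \<longrightarrow> s (h u) \<inter> s (h v) = r)"
  using assms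
proof (induction n arbitrary: s)
  case 0
  then have "s m = {}" if "m \<in> univ M" for m using that by fastforce
  then have "\<forall>u\<in>univ M. \<forall>v\<in>univ M. u \<noteq> v \<longrightarrow> s (id u) \<inter> s (id v) = {}" by simp
  then show ?case using emb_id by blast
next
  case (Suc n)
  let ?A = "\<lambda>\<beta>. {m. \<beta> \<in> s m}"
  show ?case
  proof (cases "\<exists>\<beta>. contains_copy L M (?A \<beta>)")
    case True
    then obtain \<beta> g where g: "emb L M g" "\<And>m. m \<in> univ M \<Longrightarrow> \<beta> \<in> s (g m)"
      by (auto simp: contains_copy_def)
    have gM: "g m \<in> univ M" if "m \<in> univ M" for m using g(1) that by (auto simp: emb_def)
    \<comment> \<open>Every \<open>s (g m)\<close> contains \<open>\<beta>\<close>, so its removal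
      leaves size \<open>n\<close>. In the end \<open>\<beta>\<close> returns to the kernel.\<close>
    let ?s' = "\<lambda>m. s (g m) - {\<beta>}"
    have s': "finite (?s' m) \<and> card (?s' m) = n" if "m \<in> univ M" for m
      using Suc.prems[OF gM[OF that]] g(2)[OF that] by (simp add: card_Diff_singleton)
    have "\<exists>h r. emb L M h \<and> (\<forall>u\<in>univ M. \<forall>v\<in>univ M. u \<noteq> v \<longrightarrow> ?s' (h u) \<inter> ?s' (h v) = r)"
      by (rule Suc.IH) (rule s')
    then obtain h r where h: "emb L M h"
      "\<forall>u\<in>univ M. \<forall>v\<in>univ M. u \<noteq> v \<longrightarrow> ?s' (h u) \<inter> ?s' (h v) = r"
      by (elim exE conjE) (rule that)
    have hM: "h m \<in> univ M" if "m \<in> univ M" for m using h(1) that by (auto simp: emb_def)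
    have "s ((g \<circ> h) u) \<inter> s ((g \<circ> h) v) = insert \<beta> r"
      if "u \<in> univ M" "v \<in> univ M" "u \<noteq> v" for u v
      using h(2)[rule_format, OF that] g(2)[OF hM[OF that(1)]] g(2)[OF hM[OF that(2)]] by auto
    then have "\<forall>u\<in>univ M. \<forall>v\<in>univ M. u \<noteq> v \<longrightarrow>
        s ((g \<circ> h) u) \<inter> s ((g \<circ> h) v) = insert \<beta> r"
      by blast
    with emb_comp[OF g(1) h(1)] show ?thesis by (intro exI conjI)
  next
    case False
    let ?Q = "\<lambda>E y. s y \<inter> (\<Union>z\<in>E. s z) = {}"
    have "\<exists>h. emb L M h \<and> h ` univ M \<subseteq> univ M \<and> (\<forall>j\<in>univ M. ?Q (h ` pred j) (h j))"
    proof (rule build_embedding[OF subset_refl])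
      fix D g x
      assume D: "D \<subseteq> univ M" "small D" "g ` D \<subseteq> univ M" "qtp L M D id = qtp L M D g"
        and x: "x \<in> univ M - D"
      obtain y0 where y0: "y0 \<in> univ M" "qtp_ext L M D id x = qtp_ext L M D g y0"
        using one_point_extension[OF D(2,3,1,4)] x by blast
      have "y0 \<notin> g ` D" using qtp_ext_imp_mem_iff[OF y0(2)] x by auto
      then have y0': "y0 \<in> univ M - g ` D" using y0(1) by blast
      \<comment> \<open>The members to be avoided form a small union of finite sets, which is small.
        In this case no \<open>?A \<beta>\<close> contains a copy.\<close>
      let ?\<Lambda> = "\<Union>z\<in>g ` D. s z"
      have "small ?\<Lambda>"
        using D(3) Suc.prems by (intro small_UNION small_image D(2) small_finite) auto
      then have "\<exists>y\<in>cell (g ` D) y0. \<forall>\<beta>\<in>?\<Lambda>. y \<notin> ?A \<beta>"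
        by (rule cell_not_covered) (use False D(3) small_image[OF D(2)] y0' in auto)
      then obtain y where y: "y \<in> cell (g ` D) y0" "?Q (g ` D) y"
        by auto
      \<comment> \<open>Moving from \<open>y0\<close> to \<open>y\<close> within the cell avoids the
        earlier sets without changing the type over \<open>g\<close>.\<close>
      have "qtp_ext L M D g y0 = qtp_ext L M D g y"
        by (rule qtp_ext_reindex[of L M "g ` D" id y0 id y D g]) (use y(1) in \<open>auto simp: mem_cell_iff\<close>)
      then show "\<exists>y\<in>univ M. qtp_ext L M D id x = qtp_ext L M D g y \<and> ?Q (g ` D) y"
        using y y0(2) by (intro bexI[of _ y]) (auto simp: mem_cell_iff)
    qed
    then obtain h where h: "emb L M h" "\<forall>j\<in>univ M. ?Q (h ` pred j) (h j)"
      by (elim exE conjE) (rule that)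
    have "s (h u) \<inter> s (h v) = {}" if uv: "u \<in> univ M" "v \<in> univ M" "u \<noteq> v" for u v
    proof -
      \<comment> \<open>One of the two is chosen before the other, and \<open>?Q\<close> at the
        later one gives disjointness.\<close>
      have "u \<in> pred v \<or> v \<in> pred u"
        using linear_order_card_of[of "univ M"] uv
        by (auto simp: linear_order_on_def total_on_def underS_def)
      then show ?thesis using bspec[OF h(2) uv(1)] bspec[OF h(2) uv(2)] by auto
    qed
    then have "\<forall>u\<in>univ M. \<forall>v\<in>univ M. u \<noteq> v \<longrightarrow> s (h u) \<inter> s (h v) = {}" by blast
    with h(1) show ?thesis by (intro exI conjI)
  qed
qed

end

section \<open>Isomorphic copies\<close>

text \<open>Closure puts function values into \<open>univ M\<close>, where the inverse cancels
  \<open>h\<close>.\<close>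

lemma isomorphism_sym:
  assumes h: "isomorphism L M N h" and closed: "closed_under L M (univ M)"
  shows "isomorphism L N M (inv_into (univ M) h)"
proof -
  let ?g = "inv_into (univ M) h"
  have bij: "bij_betw h (univ M) (univ N)" using h by (simp add: isomorphism_def)
  have g: "map ?g ys \<in> lists (univ M)" "map h (map ?g ys) = ys" if "ys \<in> lists (univ N)" for ys
    using that bij_betw_apply[OF bij_betw_inv_into[OF bij]] bij_betw_inv_into_right[OF bij]
    by (auto simp: in_lists_conv_set intro!: map_idI)
  show ?thesis
    unfolding isomorphism_def
  proof (intro conjI ballI impI)
    show "bij_betw ?g (univ N) (univ M)" by (rule bij_betw_inv_into[OF bij])
  next
    fix f ys assume f: "f \<in> fsyms L" "ys \<in> lists (univ N)" "length ys = farity L f"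
    have "h (fun_int M f (map ?g ys)) = fun_int N f (map h (map ?g ys))"
      using h f g(1)[OF f(2)] unfolding isomorphism_def by (simp del: map_map)
    moreover have "fun_int M f (map ?g ys) \<in> univ M"
      using closed f g(1)[OF f(2)] by (simp add: closed_under_def)
    ultimately show "?g (fun_int N f ys) = fun_int M f (map ?g ys)"
      using bij_betw_inv_into_left[OF bij] g(2)[OF f(2)] by metis
  next
    fix R ys assume R: "R \<in> rsyms L" "ys \<in> lists (univ N)" "length ys = rarity L R"
    have "rel_int M R (map ?g ys) = rel_int N R (map h (map ?g ys))"
      using h R g(1)[OF R(2)] unfolding isomorphism_def by (simp del: map_map)
    then show "rel_int N R ys = rel_int M R (map ?g ys)" using g(2)[OF R(2)] by simp
  qed
qed

lemma isomorphism_trans: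
  assumes h: "isomorphism L M N h" and g: "isomorphism L N K g"
  shows "isomorphism L M K (g \<circ> h)"
proof -
  have bij: "bij_betw h (univ M) (univ N)" using h by (simp add: isomorphism_def)
  have hl: "map h xs \<in> lists (univ N)" if "xs \<in> lists (univ M)" for xs
    using that bij_betw_apply[OF bij] by (auto simp: in_lists_conv_set)
  have "bij_betw (g \<circ> h) (univ M) (univ K)"
    using bij_betw_trans[OF bij] g unfolding isomorphism_def by blast
  then show ?thesis
    using h g hl unfolding isomorphism_def by (simp flip: map_map)
qed

lemma isomorphism_restrict_struct:
  assumes h: "isomorphism L M N h" and B: "B \<subseteq> univ M"
  shows "isomorphism L (restrict_struct M B) (restrict_struct N (h ` B)) h"
proof -
  have "xs \<in> lists (univ M)" if "xs \<in> lists B" for xs using that B by auto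
  then show ?thesis
    using h B bij_betw_subset[of h "univ M" "univ N" B]
    unfolding isomorphism_def restrict_struct_def by auto
qed

lemma closed_under_isomorphism_image:
  assumes h: "isomorphism L M N h" and B: "B \<subseteq> univ M" "closed_under L M B"
  shows "closed_under L N (h ` B)"
  unfolding closed_under_def
proof (intro ballI impI)
  fix f ys assume f: "f \<in> fsyms L" "ys \<in> lists (h ` B)" "length ys = farity L f"
  then obtain xs where xs: "xs \<in> lists B" "ys = map h xs"
    by (auto simp: lists_image)
  then have "xs \<in> lists (univ M)" using B(1) by auto
  then have "h (fun_int M f xs) = fun_int N f ys"
    using h f xs unfolding isomorphism_def by simp
  moreover have "fun_int M f xs \<in> B" using B(2) f xs by (simp add: closed_under_def)
  ultimately show "fun_int N f ys \<in> h ` B" by (metis imageI)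
qed

text \<open>Under the tuple \<open>id\<close> elements are their own variables, so a function value
  is described by an atomic equation between a variable and a term. Its preservation is the
  homomorphism law, and closure of the image follows.\<close>

lemma emb_isomorphism:
  assumes M: "is_structure L M" and h: "emb L M h"
  shows "isomorphism L M (restrict_struct M (h ` univ M)) h"
    and "closed_under L M (h ` univ M)"
proof -
  have eq: "qtp L M (univ M) id = qtp L M (univ M) h" using h by (simp add: emb_def)
  have f: "h (fun_int M f xs) = fun_int M f (map h xs)" "fun_int M f xs \<in> univ M"
    if f: "f \<in> fsyms L" "xs \<in> lists (univ M)" "length xs = farity L f" for f xs
  proof -
    show M': "fun_int M f xs \<in> univ M"
      using M f by (auto simp: is_structure_def closed_under_def)
    have "sat M id (Eq (Var (fun_int M f xs)) (Fn f (map Var xs))) =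
      sat M h (Eq (Var (fun_int M f xs)) (Fn f (map Var xs)))"
      by (rule qtp_sat_eq[OF eq]) (use f M' in auto)
    then show "h (fun_int M f xs) = fun_int M f (map h xs)" by (simp add: comp_def)
  qed
  have R: "rel_int M R xs = rel_int M R (map h xs)"
    if R: "R \<in> rsyms L" "xs \<in> lists (univ M)" "length xs = rarity L R" for R xs
  proof -
    have "sat M id (Rel R (map Var xs)) = sat M h (Rel R (map Var xs))"
      by (rule qtp_sat_eq[OF eq]) (use R in auto)
    then show ?thesis by (simp add: comp_def)
  qed
  have "inj_on h (univ M)" using qtp_imp_eq_iff[OF eq] by (auto simp: inj_on_def)
  then show "isomorphism L M (restrict_struct M (h ` univ M)) h"
    using f R by (simp add: isomorphism_def restrict_struct_def inj_on_imp_bij_betw)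
  show "closed_under L M (h ` univ M)"
    unfolding closed_under_def
  proof (intro ballI impI)
    fix g ys assume g: "g \<in> fsyms L" "ys \<in> lists (h ` univ M)" "length ys = farity L g"
    then obtain xs where xs: "xs \<in> lists (univ M)" "ys = map h xs" by (auto simp: lists_image)
    then show "fun_int M g ys \<in> h ` univ M" using f[of g xs] g by (metis imageI length_map)
  qed
qed

theorem corollary2p16:
  fixes L :: "('f, 'r) lang" and M :: "('f, 'r, 'a) struct"
  assumes "is_structure L M"
    and "infinite (univ M)"
    and "regularCard |univ M|"
    and "saturated L M |univ M|"
    and "has_qe L M"
    and "strong_univ_dup_qf L M"
  shows "sunflowerable TYPE('b) L M"
  unfolding sunflowerable_def n_sunflowerable_def
proof (intro allI conjI impI)
  show "infinite (univ M)" by fact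
  interpret duplicating_structure L M
    by standard (use assms in auto)
  fix n and Y :: "('f, 'r, 'b set) struct"
  assume Y: "is_structure L Y \<and> isomorphic L Y M \<and> (\<forall>y\<in>univ Y. finite y \<and> card y = n)"
  then obtain \<phi> where \<phi>: "isomorphism L Y M \<phi>" by (auto simp: isomorphic_def)
  \<comment> \<open>\<open>?s m\<close> is the \<open>n\<close>-element set that stands for
    \<open>m\<close> in \<open>Y\<close>.\<close>
  let ?s = "inv_into (univ Y) \<phi>"
  have s: "isomorphism L M Y ?s"
    using isomorphism_sym[OF \<phi>] Y by (simp add: is_structure_def)
  then have sY: "?s m \<in> univ Y" if "m \<in> univ M" for m
    using that bij_betw_apply by (fastforce simp: isomorphism_def)
  have card_s: "finite (?s m) \<and> card (?s m) = n" if "m \<in> univ M" for m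
    using sY[OF that] Y by blast
  have "\<exists>h r. emb L M h \<and> (\<forall>u\<in>univ M. \<forall>v\<in>univ M. u \<noteq> v \<longrightarrow> ?s (h u) \<inter> ?s (h v) = r)"
    by (rule sunflower_embedding) (rule card_s)
  then obtain h r where h: "emb L M h"
    and r: "\<forall>u\<in>univ M. \<forall>v\<in>univ M. u \<noteq> v \<longrightarrow> ?s (h u) \<inter> ?s (h v) = r"
    by (elim exE conjE) (rule that)
  let ?B = "h ` univ M"
  have B: "?B \<subseteq> univ M" using h by (simp add: emb_def)
  \<comment> \<open>The image of \<open>M\<close> under \<open>?s \<circ> h\<close>, which makes
    \<open>Z\<close> isomorphic to \<open>M\<close> and hence to \<open>Y\<close>.\<close>
  define Z where "Z = restrict_struct Y (?s ` ?B)"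
  have ZY: "univ Z \<subseteq> univ Y" using B sY by (auto simp: Z_def restrict_struct_def)
  have "closed_under L Y (?s ` ?B)"
    using closed_under_isomorphism_image[OF s B] emb_isomorphism(2)[OF assms(1) h] by blast
  then have "is_structure L Z"
    using struct by (auto simp: Z_def restrict_struct_def is_structure_def closed_under_def)
  then have "substructure L Z Y"
    using ZY by (simp add: substructure_def) (simp add: Z_def restrict_struct_def)
  moreover have "isomorphic L Z Y"
  proof -
    have "isomorphism L M Z (?s \<circ> h)"
      unfolding Z_def
      using isomorphism_trans[OF emb_isomorphism(1)[OF assms(1) h]
          isomorphism_restrict_struct[OF s B]] .
    then have "isomorphism L Z M (inv_into (univ M) (?s \<circ> h))"
      using isomorphism_sym struct by (auto simp: is_structure_def)
    from isomorphism_trans[OF this s] show ?thesis unfolding isomorphic_def by blast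
  qed
  moreover have "sunflower (univ Z)"
    unfolding sunflower_def
  proof (intro conjI exI[of _ r] ballI impI)
    show "finite p" if "p \<in> univ Z" for p using that ZY Y by blast
    show "p \<inter> q = r" if "p \<in> univ Z" "q \<in> univ Z" "p \<noteq> q" for p q
      using that r by (auto simp: Z_def restrict_struct_def)
  qed
  ultimately show "\<exists>Z. substructure L Z Y \<and> isomorphic L Z Y \<and> sunflower (univ Z)" by blast
qed

end
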